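(* Let $\mathbb{K}=\mathbb{R}$ or $\mathbb{C}$, $m\ge 1$, $d\ge 1$, $n\ge 0$, and let $G\in C^\infty(\mathbb{K}^{1+(1+n)d},\mathbb{K}^d)$. Consider the system of differential algebraic equations $G[x,y,y',\dots,y^{(n)}]=0$ with $x\in\mathbb{K}$ and $y,y',\dots,y^{(n)}\in\mathbb{K}^d$. Let $(c_{m+n},\dots,c_0)\in\mathbb{K}^{(m+n+1)d}$ (each $c_i\in\mathbb{K}^d$) be given with $G[0,c_0,\dots,c_n]=0$. With the quantities $S_k$, $\bar R_i$, $H$, $g$ defined in the context, assume (i) $S_{m-1}(c_{m-1+n},\dots,c_0)=0\in\mathbb{K}^{md,\,md}$ and $S_m(c_{m+n},\dots,c_0)\neq 0\in\mathbb{K}^{(m+1)d,\,(m+1)d}$; (ii) $\bar R_1(c_n,\dots,c_0)=\cdots=\bar R_{2m}(c_{m+n},\dots,c_0)=0\in\mathbb{K}^d$. Then the following hold. 1) If $g(l,c_{m+n},\dots,c_0)\neq 0$ for all integers $l\ge 0$, then $(c_{m+n},\dots,c_0)$ can uniquely be continued to a power series solution $$y(x)=c_0+c_1x+\cdots+\frac{1}{(m+n)!}c_{m+n}x^{m+n}+\sum_{i=m+1+n}^{\infty}\frac{1}{i!}c_i x^i$$ of $G[x,y,y',\dots,y^{(n)}]=0$, the coefficients being given recursively for $l=0,1,2,\dots$ by $$c_{m+1+l+n}=-H(l,c_{m+n},\dots,c_0)^{-1}\,\bar R_{2m+1+l}(c_{m+l+n},\dots,c_0).$$ 2) Suppose that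 the integer solutions $l\geq 0$ of $g(l,c_{m+n},\dots,c_0)=0$ are $0\le \bar l_1<\cdots<\bar l_p$ with $p\ge 1$, $p\le md$. Suppose in addition that there is at least one choice of $c_{m+n+1},\dots,c_{m+n+\bar l_p}\in\mathbb{K}^d$ satisfying the recursion equations $$H(l,c_{m+n},\dots,c_0)\,c_{m+1+l+n}+\bar R_{2m+1+l}(c_{m+l+n},\dots,c_0)=0,\qquad 0\le l<\bar l_p,$$ such that $$\bar R_{2m+1+\bar l_i}(c_{m+\bar l_i+n},\dots,c_0)\in \mathrm{Range}\,H(\bar l_i,c_{m+n},\dots,c_0)\qquad\text{for } i=1,\dots,p.$$ Then there exists a family of power series solutions of $G[x,y,y',\dots,y^{(n)}]=0$ continuing $(c_{m+n},\dots,c_0)$, of dimension $q$ with $1\le q\le md^2$.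
   Context: **Expansion coefficients.** Put $z=(x,y_0,\dots,y_n)\in\mathbb{K}^{1+(1+n)d}$ with $x\in\mathbb{K}$, $y_j\in\mathbb{K}^d$. For a formal series $z(\varepsilon)=\sum_{i\ge0}\frac{1}{i!}z_i\varepsilon^i$, $z_i=(x_i,y_{0,i},\dots,y_{n,i})$, define $T^i(z_i,\dots,z_0)\in\mathbb{K}^d$ by the (formal Taylor) expansion $G[z(\varepsilon)]=\sum_{i\ge 0}\frac{1}{i!}T^i(z_i,\dots,z_0)\varepsilon^i$, so $T^0=G[z_0]$, $T^1=G'[z_0]z_1$, $T^2=G'[z_0]z_2+G''[z_0]z_1^2$, etc. For $i\ge 0$ and $0\le j\le n$ let $T^{2i}_{y_{j,i}}\in\mathbb{K}^{d,d}$ be the partial derivative of $T^{2i}(z_{2i},\dots,z_0)$ with respect to the variable $y_{j,i}$ (all components of all $z_s$ being treated as independent variables); it depends only on $z_i,\dots,z_0$. Set $T^{2i}_{y_{j,i}}:=0\in\mathbb{K}^{d,d}$ if $j<0$. **Substitution.** Given a sequence $c_0,c_1,c_2,\dots\in\mathbb{K}^d$, all $T^i$ and $T^{2i}_{y_{j,i}}$ are evaluated (after differentiation) at $x_1=1$, $x_i=0$ for $i\ne1$, and $y_{j,i}=c_{i+j}$; that is, $x=\varepsilon$ and $y_j=y^{(j)}$ for $y(x)=\sum_i\frac{1}{i!}c_ix^i$. Then $T^i$ becomes a function $T^i(c_{i+n},\dots,c_0)$. A *power series solution* is a formal power series $y(x)=\sum_{i\ge0}\frac1{i!}c_ix^i$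 with $T^i(c_{i+n},\dots,c_0)=0$ for all $i\ge 0$. **Matrices.** For $k\ge0$, $l\ge0$, $0\le t\le k$ let $$\gamma_t^{2k+l}:=\binom{2k+1+l}{t}\binom{2t}{t}^{-1},\qquad \Gamma_k(l):=[\gamma_0^{2k+l}\ \cdots\ \gamma_k^{2k+l}],$$ where each scalar $\gamma_t^{2k+l}$ acts on $\mathbb{K}^d$ by multiplication (so $\Gamma_k(l)$ is the $d\times(k+1)d$ block row with blocks $\gamma_t^{2k+l}I_d$). Let $S_k(c_{k+n},\dots,c_0)\in\mathbb{K}^{(k+1)d,(k+1)d}$ be the block upper triangular matrix whose $d\times d$ block in block row $i$ and block column $s$ ($0\le i,s\le k$) is $T^{2i}_{y_{n-(s-i),i}}$ if $s\ge i$ and $0$ if $s<i$. **Remainders.** For $k,l\ge 0$ one has $$T^{2k+1+l}(c_{2k+1+l+n},\dots,c_0)=\Gamma_k(l)\,S_k(c_{k+n},\dots,c_0)\begin{pmatrix}c_{2k+1+l+n}\\ \vdots\\ c_{k+1+l+n}\end{pmatrix}+\bar R_{2k+1+l}(c_{k+l+n},\dots,c_0),$$ which defines $\bar R_{2k+1+l}$; it depends only on $c_{k+l+n},\dots,c_0$. Since the splitting depends on the pair $(k,l)$, the convention is: $\bar R_1,\dots,\bar R_{2m}$ are taken with $k=0,\dots,m-1$ and $l\in\{0,1\}$, i.e. $\bar R_{2k+1}(c_{k+n},\dots,c_0)$ with $(k,0)$ and $\bar R_{2k+2}(c_{k+1+n},\dots,c_0)$ with $(k,1)$; for $l\ge0$,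 $\bar R_{2m+1+l}(c_{m+l+n},\dots,c_0)$ is taken with the pair $(m,l)$. **$H$ and $g$.** For $l\ge 0$, $$H(l,c_{m+n},\dots,c_0):=\sum_{i=0}^m\gamma_i^{2m+l}\,T^{2i}_{y_{n-m+i,i}}\in\mathbb{K}^{d,d},\qquad g(l,c_{m+n},\dots,c_0):=\det H(l,c_{m+n},\dots,c_0),$$ where $g$ is a polynomial in $l$ of degree at most $md$. **Dimension.** In part 2) the family consists of the power series solutions whose first coefficients are the given $c_0,\dots,c_{m+n}$. It is parametrized by the coefficients $c_{m+1+\bar l_1+n},\dots,c_{m+1+\bar l_p+n}$ occurring at the integer roots; its dimension is the dimension of the corresponding algebraic set of tuples $(c_{m+1+\bar l_1+n},\dots,c_{m+1+\bar l_p+n})$ in $\mathbb{K}^{dp}$. *)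

theory Defs
  imports "HOL-Analysis.Analysis" "HOL-Library.Extended_Nat"
begin

text \<open>
  Scalars: the sort \<open>{real_normed_field, euclidean_space}\<close> describes finite-dimensional
  commutative real division algebras with a multiplicative norm, hence (up to isomorphism)
  exactly the two fields \<open>real\<close> and \<open>complex\<close>, both of which are instances.

  The space \<open>K^(1+(1+n)d)\<close> of the points \<open>(x, y_0, ..., y_n)\<close> is the type
  \<open>'k \<times> (('k^'d)^'j)\<close>, where \<open>'j\<close> is a finite linearly ordered type with \<open>n + 1\<close> elements;
  the element with exactly \<open>r\<close> predecessors stands for the index \<open>r \<in> {0..n}\<close>.
\<close>

definition idx :: "'j::{finite,linorder} \<Rightarrow> nat" where
  "idx j = card {..<j}"

definition kscale ::
  "'k \<Rightarrow> 'k::{real_normed_field,euclidean_space} \<times> (('k^'d)^'j) \<Rightarrow> 'k \<times> (('k^'d)^'j)" where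
  "kscale a z = (a * fst z, \<chi> j. a *s (snd z $ j))"

text \<open>
  Smoothness over the scalar field: Frechet derivatives of all orders exist and are linear over
  \<open>'k\<close>. For \<open>real\<close> homogeneity is automatic; for \<open>complex\<close> this means holomorphic.
\<close>

primrec Ck ::
  "nat \<Rightarrow> ('k::{real_normed_field,euclidean_space} \<times> (('k^'d)^'j) \<Rightarrow> 'k^'d) \<Rightarrow> bool" where
  "Ck 0 f \<longleftrightarrow> continuous_on UNIV f"
| "Ck (Suc r) f \<longleftrightarrow>
     (\<exists>f'. (\<forall>z. (f has_derivative f' z) (at z) \<and> (\<forall>a v. f' z (kscale a v) = a *s f' z v)) \<and>
           (\<forall>v. Ck r (\<lambda>z. f' z v)))"

definition C_infinity ::
  "('k::{real_normed_field,euclidean_space} \<times> (('k^'d)^'j) \<Rightarrow> 'k^'d) \<Rightarrow> bool" where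
  "C_infinity f \<longleftrightarrow> (\<forall>r. Ck r f)"


section \<open>Expansion coefficients\<close>

text \<open>
  \<open>T G i z\<close> is \<open>i!\<close> times the \<open>i\<close>-th Taylor coefficient at 0 of
  \<open>\<epsilon> \<mapsto> G[z_0 + z_1 \<epsilon> + ... + z_i \<epsilon>^i / i!]\<close>. Truncating the formal series \<open>z(\<epsilon>)\<close> after the order
  \<open>i\<close> makes it an actual function without changing this coefficient.
\<close>

definition T ::
  "('k::{real_normed_field,euclidean_space} \<times> (('k^'d)^'j) \<Rightarrow> 'k^'d) \<Rightarrow> nat \<Rightarrow>
   (nat \<Rightarrow> 'k \<times> (('k^'d)^'j)) \<Rightarrow> 'k^'d" where
  "T G i z = (\<chi> a. (deriv ^^ i) (\<lambda>\<epsilon>. G (\<Sum>s\<le>i. kscale (\<epsilon> ^ s / fact s) (z s)) $ a) 0)"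

text \<open>
  \<open>T_y G i j z\<close> is the Jacobian matrix of \<open>T G (2 * i)\<close> with respect to \<open>y_{j,i}\<close>, i.e. the
  \<open>j\<close>-th \<open>y\<close>-component of the argument \<open>z i\<close>; row \<open>a\<close> and column \<open>b\<close> hold the derivative of
  component \<open>a\<close> in direction \<open>b\<close>.
\<close>

definition T_y ::
  "('k::{real_normed_field,euclidean_space} \<times> (('k^'d)^('j::{finite,linorder})) \<Rightarrow> 'k^'d) \<Rightarrow> nat \<Rightarrow> int \<Rightarrow>
   (nat \<Rightarrow> 'k \<times> (('k^'d)^('j::{finite,linorder}))) \<Rightarrow> 'k^'d^'d" where
  "T_y G i j z =
     (if j < 0 then 0
      else \<chi> a b. deriv (\<lambda>\<tau>. T G (2 * i)
             (z(i := z i + (0, \<chi> j'. if int (idx j') = j then axis b \<tau> else 0))) $ a) 0)"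

text \<open>
  Sequences \<open>c\<close> stand for \<open>c_0, c_1, c_2, ...\<close>, and for the formal power series
  \<open>y(x) = \<Sum>i. c_i x^i / i!\<close>. The substitution is \<open>x = \<epsilon>\<close> and \<open>y_j = y^(j)(\<epsilon>)\<close>.
\<close>

definition subst_series ::
  "(nat \<Rightarrow> 'k^'d) \<Rightarrow> nat \<Rightarrow> 'k::{real_normed_field,euclidean_space} \<times> (('k^'d)^('j::{finite,linorder}))" where
  "subst_series c i = (if i = 1 then 1 else 0, \<chi> j. c (i + idx j))"

definition power_series_solution ::
  "('k::{real_normed_field,euclidean_space} \<times> (('k^'d)^('j::{finite,linorder})) \<Rightarrow> 'k^'d) \<Rightarrow>
   (nat \<Rightarrow> 'k^'d) \<Rightarrow> bool" where
  "power_series_solution G c \<longleftrightarrow> (\<forall>i. T G i (subst_series c) = 0)"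


section \<open>Matrices and remainders\<close>

definition \<gamma> :: "nat \<Rightarrow> nat \<Rightarrow> nat \<Rightarrow> 'k::field_char_0" where
  "\<gamma> k l t = of_nat ((2 * k + 1 + l) choose t) / of_nat ((2 * t) choose t)"

text \<open>
  The \<open>(k+1)d \<times> (k+1)d\<close> matrix \<open>S_k\<close> is represented by its \<open>d \<times> d\<close> blocks: \<open>S G n k c i s\<close> is the
  block in block row \<open>i\<close> and block column \<open>s\<close>, and it is \<open>0\<close> outside the range \<open>0 \<le> i, s \<le> k\<close>.
\<close>

definition S ::
  "('k::{real_normed_field,euclidean_space} \<times> (('k^'d)^('j::{finite,linorder})) \<Rightarrow> 'k^'d) \<Rightarrow>
   nat \<Rightarrow> nat \<Rightarrow> (nat \<Rightarrow> 'k^'d) \<Rightarrow> nat \<Rightarrow> nat \<Rightarrow> 'k^'d^'d" where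
  "S G n k c i s =
     (if i \<le> s \<and> s \<le> k then T_y G i (int n - (int s - int i)) (subst_series c) else 0)"

text \<open>The product of \<open>\<Gamma>_k(l)\<close>, \<open>S_k\<close> and the column \<open>(c_{2k+1+l+n}, ..., c_{k+1+l+n})\<close>.\<close>

definition \<Gamma>S ::
  "('k::{real_normed_field,euclidean_space} \<times> (('k^'d)^('j::{finite,linorder})) \<Rightarrow> 'k^'d) \<Rightarrow>
   nat \<Rightarrow> nat \<Rightarrow> nat \<Rightarrow> (nat \<Rightarrow> 'k^'d) \<Rightarrow> 'k^'d" where
  "\<Gamma>S G n k l c =
     (\<Sum>t\<le>k. \<gamma> k l t *s (\<Sum>s\<le>k. S G n k c t s *v c (2 * k + 1 + l + n - s)))"

text \<open>
  The remainder is the unique vector which satisfies the splitting of \<open>T^(2k+1+l)\<close> for all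
  sequences with the prescribed entries \<open>c_0, ..., c_{k+l+n}\<close>; so it is by definition a function
  of these entries only.
\<close>

definition R_bar ::
  "('k::{real_normed_field,euclidean_space} \<times> (('k^'d)^('j::{finite,linorder})) \<Rightarrow> 'k^'d) \<Rightarrow>
   nat \<Rightarrow> nat \<Rightarrow> nat \<Rightarrow> (nat \<Rightarrow> 'k^'d) \<Rightarrow> 'k^'d" where
  "R_bar G n k l c =
     (THE r. \<forall>c'. (\<forall>i\<le>k + l + n. c' i = c i) \<longrightarrow>
        T G (2 * k + 1 + l) (subst_series c') = \<Gamma>S G n k l c' + r)"

definition H ::
  "('k::{real_normed_field,euclidean_space} \<times> (('k^'d)^('j::{finite,linorder})) \<Rightarrow> 'k^'d) \<Rightarrow>
   nat \<Rightarrow> nat \<Rightarrow> nat \<Rightarrow> (nat \<Rightarrow> 'k^'d) \<Rightarrow> 'k^'d^'d" where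
  "H G n m l c =
     (\<chi> a b. \<Sum>i\<le>m. \<gamma> m l i * T_y G i (int n - int m + int i) (subst_series c) $ a $ b)"

definition g ::
  "('k::{real_normed_field,euclidean_space} \<times> (('k^'d)^('j::{finite,linorder})) \<Rightarrow> 'k^'d) \<Rightarrow>
   nat \<Rightarrow> nat \<Rightarrow> nat \<Rightarrow> (nat \<Rightarrow> 'k^'d) \<Rightarrow> 'k" where
  "g G n m l c = det (H G n m l c)"

text \<open>The power series solutions which continue \<open>c_0, ..., c_N\<close>.\<close>

definition continuations ::
  "('k::{real_normed_field,euclidean_space} \<times> (('k^'d)^('j::{finite,linorder})) \<Rightarrow> 'k^'d) \<Rightarrow>
   nat \<Rightarrow> (nat \<Rightarrow> 'k^'d) \<Rightarrow> (nat \<Rightarrow> 'k^'d) set" where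
  "continuations G N c = {c'. (\<forall>i\<le>N. c' i = c i) \<and> power_series_solution G c'}"


section \<open>Algebraic sets and their dimension\<close>

text \<open>Affine space with coordinates indexed by a set \<open>I\<close> is \<open>I \<rightarrow>\<^sub>E UNIV\<close>.\<close>

inductive polynomial_fun :: "'i set \<Rightarrow> (('i \<Rightarrow> 'k::comm_ring_1) \<Rightarrow> 'k) \<Rightarrow> bool" for I where
  const: "polynomial_fun I (\<lambda>v. a)"
| coord: "i \<in> I \<Longrightarrow> polynomial_fun I (\<lambda>v. v i)"
| add: "polynomial_fun I f \<Longrightarrow> polynomial_fun I h \<Longrightarrow> polynomial_fun I (\<lambda>v. f v + h v)"
| mult: "polynomial_fun I f \<Longrightarrow> polynomial_fun I h \<Longrightarrow> polynomial_fun I (\<lambda>v. f v * h v)"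

definition algebraic_set :: "'i set \<Rightarrow> ('i \<Rightarrow> 'k::comm_ring_1) set \<Rightarrow> bool" where
  "algebraic_set I V \<longleftrightarrow>
     (\<exists>P. (\<forall>f\<in>P. polynomial_fun I f) \<and> V = {v \<in> I \<rightarrow>\<^sub>E UNIV. \<forall>f\<in>P. f v = 0})"

definition irreducible_algebraic_set :: "'i set \<Rightarrow> ('i \<Rightarrow> 'k::comm_ring_1) set \<Rightarrow> bool" where
  "irreducible_algebraic_set I V \<longleftrightarrow>
     algebraic_set I V \<and> V \<noteq> {} \<and>
     (\<forall>A B. algebraic_set I A \<longrightarrow> algebraic_set I B \<longrightarrow> V = A \<union> B \<longrightarrow> V = A \<or> V = B)"

text \<open>
  Dimension of an algebraic set: the Krull dimension of its Zariski topology, i.e. the supremum of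
  the lengths \<open>r\<close> of chains of irreducible algebraic subsets \<open>W_0 \<subset> W_1 \<subset> ... \<subset> W_r\<close>. The empty
  set gets the value \<open>0\<close>.
\<close>

definition algebraic_dim :: "'i set \<Rightarrow> ('i \<Rightarrow> 'k::comm_ring_1) set \<Rightarrow> enat" where
  "algebraic_dim I V =
     (SUP r \<in> {r. \<exists>W. (\<forall>k\<le>r. irreducible_algebraic_set I (W k) \<and> W k \<subseteq> V) \<and>
                      (\<forall>k<r. W k \<subset> W (Suc k))}. enat r)"

end

theory Submission
  imports Defs
begin

text \<open>
  Why the theorem holds. Let a path \<open>z(\<epsilon>) = \<Sum>s. z_s \<epsilon>^s / s!\<close> run through a point of the
  domain of \<open>G\<close>. The coefficient \<open>T^N\<close> of \<open>G[z(\<epsilon>)]\<close> is a sum of terms \<open>G^(r)[z_0] z_{s_1} ... z_{s_r}\<close>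
  with \<open>s_1 + ... + s_r = N\<close>. If \<open>N = 2k + 1 + l\<close>, two indices above \<open>k + l\<close> already sum up to more
  than \<open>N\<close>, so at most one factor has such an index and \<open>T^N\<close> is affine in
  \<open>z_{k+l+1}, ..., z_N\<close> jointly. The coefficient of \<open>z_{N-t}\<close>, \<open>t \<le> k\<close>, is \<open>binomial N t\<close> times the
  \<open>t\<close>-th derivative of \<open>G'\<close> along the path, and the same derivative occurs in the Jacobian of
  \<open>T^{2t}\<close> with respect to \<open>z_t\<close>, there with the factor \<open>binomial (2t) t\<close>. The quotient of the two
  factors is \<open>\<gamma>_t\<close>; this is the splitting of \<open>T^{2k+1+l}\<close> into \<open>\<Gamma>_k S_k\<close> and a remainder
  (\<open>T_splitting\<close>). It also shows what the remainder is: the value of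
  \<open>T^{2k+1+l}\<close> at the sequence in which all coefficients above \<open>k + l + n\<close> are replaced by zero
  (\<open>R_bar_eq\<close>).

  The proof does not expand \<open>G[z(\<epsilon>)]\<close> into multilinear terms. By the chain rule and the Leibniz rule
  the coefficients satisfy a recursion on \<open>N\<close> in which \<open>G\<close> is replaced by its partial derivatives; the
  function \<open>taylor_coeff\<close> is defined by this recursion. Locality, polynomial dependence on
  \<open>z_1, z_2, ...\<close> and the formula for the derivative in the direction of another path
  (\<open>taylor_coeff_variation\<close>) follow by induction. The only analytic input beyond the chain rule is the
  symmetry of second derivatives.

  Since \<open>S_{m-1} = 0\<close>, only the last block column of \<open>S_m\<close> survives, and \<open>\<Gamma>_m(l) S_m\<close> reduces to
  \<open>H(l)\<close> acting on \<open>c_{m+1+l+n}\<close>. For \<open>T^1, ..., T^{2m}\<close> the matrix part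
  vanishes altogether, and the remainders are zero by assumption. Hence the
  continuations are exactly the solutions of the recursion
  \<open>H(l) c_{m+1+l+n} + R_{2m+1+l}(c_{m+l+n}, ..., c_0) = 0\<close> for \<open>l = 0, 1, ...\<close> (\<open>continuations_iff\<close>).
  If all \<open>H(l)\<close> are invertible, this has exactly one solution, which is part 1.

  For part 2, choose the coefficients at the roots of \<open>g\<close> freely and compute all others by the
  recursion. They are polynomials in the free ones, so the equations at the roots
  describe an algebraic set in \<open>K^{dp}\<close>, and a solution is determined by its point in this set. At the
  last root \<open>H\<close> is singular and all later steps are regular; so the given solvable choice yields a
  whole affine line in the set, and its dimension is at least 1. An upper bound is the
  dimension \<open>dp \<le> m d^2\<close> of the ambient space: functions which vanish on one member of a chain of
  irreducible sets but not on the next are algebraically independent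
  (\<open>chain_monomials_independent\<close>), and a comparison of the numbers of monomials excludes more than
  \<open>dp\<close> algebraically independent polynomials in \<open>dp\<close> variables (\<open>irreducible_chain_length\<close>).
\<close>

section \<open>Symmetry of second derivatives\<close>

text \<open>
  The second difference over the parallelogram spanned by \<open>h u\<close> and \<open>h v\<close> is symmetric in \<open>u\<close> and
  \<open>v\<close>, and it is \<open>h^2\<close> times the iterated derivative up to \<open>o(h^2)\<close>. The mean value inequality along
  the edge \<open>u\<close> reduces it to increments of \<open>\<lambda>x. f' x u\<close>, for which the linearization at \<open>z\<close> is
  available.
\<close>

lemma second_difference_estimate:
  fixes f :: "'a::real_normed_vector \<Rightarrow> 'b::real_normed_vector"
  assumes f: "\<And>x. (f has_derivative f' x) (at x)"
    and fu: "((\<lambda>x. f' x u) has_derivative D) (at z)"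
    and "\<epsilon> > 0"
  shows "\<exists>\<delta>>0. \<forall>h. 0 < h \<and> h < \<delta> \<longrightarrow>
    norm (f (z + h *\<^sub>R u + h *\<^sub>R v) - f (z + h *\<^sub>R u) - f (z + h *\<^sub>R v) + f z - (h * h) *\<^sub>R D v) \<le> \<epsilon> * (h * h)"
proof -
  define C where "C = 2 * norm u + norm v + 1"
  have C: "C > 0" unfolding C_def by (smt (verit) norm_ge_zero)
  define e where "e = \<epsilon> / C"
  have e: "e > 0" using C \<open>\<epsilon> > 0\<close> by (simp add: e_def)
  have lin: "bounded_linear D" using fu by (rule has_derivative_bounded_linear)
  obtain d where d: "d > 0"
    and dd: "\<And>y. norm (y - z) < d \<Longrightarrow> norm (f' y u - f' z u - D (y - z)) \<le> e * norm (y - z)"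
    using fu e unfolding has_derivative_at_alt by blast
  show ?thesis
  proof (intro exI[of _ "d / C"] conjI allI impI)
    show "d / C > 0" using d C by simp
    fix h :: real assume h: "0 < h \<and> h < d / C"
    have hC: "h * C < d" using h C by (simp add: pos_less_divide_eq)
    \<comment> \<open>The increment of \<open>\<phi>\<close> over \<open>[0, h]\<close> is the second difference minus its main term.\<close>
    define \<phi> where "\<phi> = (\<lambda>y::real. f (z + y *\<^sub>R u + h *\<^sub>R v) - f (z + y *\<^sub>R u) - (y * h) *\<^sub>R D v)"
    have der: "(\<phi> has_derivative (\<lambda>t. t *\<^sub>R (f' (z + y *\<^sub>R u + h *\<^sub>R v) u - f' (z + y *\<^sub>R u) u - h *\<^sub>R D v))) (at y within {0..h})" for y
    proof -
      have 1: "((\<lambda>y. f (z + y *\<^sub>R u + h *\<^sub>R v)) has_derivative (\<lambda>t. f' (z + y *\<^sub>R u + h *\<^sub>R v) (t *\<^sub>R u))) (at y within {0..h})"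
        by (rule has_derivative_compose[OF _ f]) (auto intro!: derivative_eq_intros)
      have 2: "((\<lambda>y. f (z + y *\<^sub>R u)) has_derivative (\<lambda>t. f' (z + y *\<^sub>R u) (t *\<^sub>R u))) (at y within {0..h})"
        by (rule has_derivative_compose[OF _ f]) (auto intro!: derivative_eq_intros)
      have l: "f' x (t *\<^sub>R u) = t *\<^sub>R f' x u" for x t
        using f[of x] by (simp add: has_derivative_bounded_linear linear_simps)
      show ?thesis unfolding \<phi>_def
        by (rule derivative_eq_intros 1 2 refl)+ (simp add: l algebra_simps)
    qed
    have bnd: "norm (f' (z + y *\<^sub>R u + h *\<^sub>R v) u - f' (z + y *\<^sub>R u) u - h *\<^sub>R D v) \<le> e * (h * C)" if y: "y \<in> {0..h}" for y
    proof -
      have n2: "norm (y *\<^sub>R u) \<le> h * norm u"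
        using y by (auto intro: mult_right_mono)
      have n1: "norm (y *\<^sub>R u + h *\<^sub>R v) \<le> h * norm u + h * norm v"
        by (rule order_trans[OF norm_triangle_ineq]) (use n2 h in auto)
      have hn: "h * norm u \<ge> 0" "h * norm v \<ge> 0" "h * C = 2 * (h * norm u) + h * norm v + h"
        using h by (auto simp: C_def algebra_simps)
      have a1: "norm (f' (z + y *\<^sub>R u + h *\<^sub>R v) u - f' z u - D (y *\<^sub>R u + h *\<^sub>R v)) \<le> e * norm (y *\<^sub>R u + h *\<^sub>R v)"
        using dd[of "z + y *\<^sub>R u + h *\<^sub>R v"] n1 hn hC h by (simp add: add.assoc)
      have a2: "norm (f' (z + y *\<^sub>R u) u - f' z u - D (y *\<^sub>R u)) \<le> e * norm (y *\<^sub>R u)"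
      proof -
        have "norm (y *\<^sub>R u) < d" using n2 hn hC h by linarith
        then show ?thesis using dd[of "z + y *\<^sub>R u"] by simp
      qed
      have "f' (z + y *\<^sub>R u + h *\<^sub>R v) u - f' (z + y *\<^sub>R u) u - h *\<^sub>R D v =
        (f' (z + y *\<^sub>R u + h *\<^sub>R v) u - f' z u - D (y *\<^sub>R u + h *\<^sub>R v)) - (f' (z + y *\<^sub>R u) u - f' z u - D (y *\<^sub>R u))"
        using lin by (simp add: linear_simps algebra_simps)
      also have "norm \<dots> \<le> e * norm (y *\<^sub>R u + h *\<^sub>R v) + e * norm (y *\<^sub>R u)"
        by (rule order_trans[OF norm_triangle_ineq4]) (use a1 a2 in auto)
      also have "\<dots> = e * (norm (y *\<^sub>R u + h *\<^sub>R v) + norm (y *\<^sub>R u))" by (simp add: algebra_simps)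
      also have "\<dots> \<le> e * (h * C)"
        using n1 n2 hn h e by (intro mult_left_mono) auto
      finally show ?thesis .
    qed
    have "norm (\<phi> h - \<phi> 0) \<le> (e * (h * C)) * norm (h - 0)"
    proof (rule differentiable_bound[of "{0..h}"])
      fix y assume y: "y \<in> {0..h}"
      show "onorm (\<lambda>t. t *\<^sub>R (f' (z + y *\<^sub>R u + h *\<^sub>R v) u - f' (z + y *\<^sub>R u) u - h *\<^sub>R D v)) \<le> e * (h * C)"
        by (rule onorm_le) (use bnd[OF y] in \<open>simp add: mult.commute mult_left_mono\<close>)
    qed (use der h in auto)
    also have "\<dots> = \<epsilon> * (h * h)" using h C by (simp add: e_def)
    finally show "norm (f (z + h *\<^sub>R u + h *\<^sub>R v) - f (z + h *\<^sub>R u) - f (z + h *\<^sub>R v) + f z - (h * h) *\<^sub>R D v) \<le> \<epsilon> * (h * h)"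
      by (simp add: \<phi>_def algebra_simps)
  qed
qed

lemma second_derivative_symmetric:
  fixes f :: "'a::real_normed_vector \<Rightarrow> 'b::real_normed_vector"
  assumes f: "\<And>x. (f has_derivative f' x) (at x)"
    and fu: "((\<lambda>x. f' x u) has_derivative Du) (at z)"
    and fv: "((\<lambda>x. f' x v) has_derivative Dv) (at z)"
  shows "Du v = Dv u"
proof (rule ccontr)
  assume "Du v \<noteq> Dv u"
  define \<epsilon> where "\<epsilon> = norm (Du v - Dv u) / 3"
  have \<epsilon>: "\<epsilon> > 0" using \<open>Du v \<noteq> Dv u\<close> by (simp add: \<epsilon>_def)
  obtain d1 where d1: "d1 > 0" "\<And>h. 0 < h \<and> h < d1 \<Longrightarrow>
    norm (f (z + h *\<^sub>R u + h *\<^sub>R v) - f (z + h *\<^sub>R u) - f (z + h *\<^sub>R v) + f z - (h * h) *\<^sub>R Du v) \<le> \<epsilon> * (h * h)"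
    using second_difference_estimate[OF f fu \<epsilon>, of v] by blast
  obtain d2 where d2: "d2 > 0" "\<And>h. 0 < h \<and> h < d2 \<Longrightarrow>
    norm (f (z + h *\<^sub>R v + h *\<^sub>R u) - f (z + h *\<^sub>R v) - f (z + h *\<^sub>R u) + f z - (h * h) *\<^sub>R Dv u) \<le> \<epsilon> * (h * h)"
    using second_difference_estimate[OF f fv \<epsilon>, of u] by blast
  define h where "h = min d1 d2 / 2"
  have h: "h > 0" "h < d1" "h < d2" using d1(1) d2(1) by (auto simp: h_def min_def)
  define A where "A = f (z + h *\<^sub>R u + h *\<^sub>R v) - f (z + h *\<^sub>R u) - f (z + h *\<^sub>R v) + f z"
  have A': "f (z + h *\<^sub>R v + h *\<^sub>R u) - f (z + h *\<^sub>R v) - f (z + h *\<^sub>R u) + f z = A"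
    by (simp add: A_def algebra_simps)
  have 1: "norm (A - (h * h) *\<^sub>R Du v) \<le> \<epsilon> * (h * h)" using d1(2)[of h] h by (simp add: A_def)
  have 2: "norm (A - (h * h) *\<^sub>R Dv u) \<le> \<epsilon> * (h * h)" using d2(2)[of h] h by (simp add: A')
  have "(h * h) *\<^sub>R (Du v - Dv u) = (A - (h * h) *\<^sub>R Dv u) - (A - (h * h) *\<^sub>R Du v)"
    by (simp add: algebra_simps)
  then have "norm ((h * h) *\<^sub>R (Du v - Dv u)) \<le> 2 * \<epsilon> * (h * h)"
    using norm_triangle_ineq4[of "A - (h * h) *\<^sub>R Dv u" "A - (h * h) *\<^sub>R Du v"] 1 2 by simp
  then have "(h * h) * (3 * \<epsilon>) \<le> (h * h) * (2 * \<epsilon>)"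
    using h by (simp add: \<epsilon>_def mult.commute)
  moreover have "h * h > 0" using h by simp
  ultimately have "3 * \<epsilon> \<le> 2 * \<epsilon>" by (metis mult_le_cancel_left_pos)
  then show False using \<epsilon> by simp
qed

section \<open>Smooth functions on \<open>K^e\<close> and their partial derivatives\<close>

text \<open>
  Coinduction expresses "partial derivatives of all orders exist": a smooth function has a
  total derivative with coefficients that are smooth again. The coefficients are multiplied in \<open>K\<close>, so
  for complex scalars this is holomorphy.
\<close>

coinductive smooth_fun :: "('k::{real_normed_field,euclidean_space}^'e \<Rightarrow> 'k) \<Rightarrow> bool" where
  "(\<And>z. (f has_derivative (\<lambda>v. \<Sum>e\<in>UNIV. D e z * v $ e)) (at z)) \<Longrightarrow> (\<And>e. smooth_fun (D e)) \<Longrightarrow>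
    smooth_fun f"

definition pd :: "'e \<Rightarrow> ('k::{real_normed_field,euclidean_space}^'e \<Rightarrow> 'k) \<Rightarrow> 'k^'e \<Rightarrow> 'k" where
  "pd e f z = frechet_derivative f (at z) (axis e 1)"

lemma pd_eqI:
  assumes "(f has_derivative (\<lambda>v. \<Sum>e\<in>UNIV. D e z * v $ e)) (at z)"
  shows "pd e f z = D e z"
proof -
  have "frechet_derivative f (at z) = (\<lambda>v. \<Sum>e\<in>UNIV. D e z * v $ e)"
    using frechet_derivative_at[OF assms] by simp
  then show ?thesis
    by (simp add: pd_def axis_def if_distrib cong: if_cong)
qed

lemma smooth_fun_partial_derivatives:
  assumes "smooth_fun f"
  shows "(f has_derivative (\<lambda>v. \<Sum>e\<in>UNIV. pd e f z * v $ e)) (at z) \<and> smooth_fun (pd e f)"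
proof -
  obtain D where D: "\<And>z. (f has_derivative (\<lambda>v. \<Sum>e\<in>UNIV. D e z * v $ e)) (at z)"
    "\<And>e. smooth_fun (D e)"
    using assms by (cases rule: smooth_fun.cases) blast
  have "pd e f = D e" for e by (intro ext pd_eqI D(1))
  then show ?thesis using D by simp
qed

lemmas smooth_fun_has_derivative = smooth_fun_partial_derivatives[THEN conjunct1]
  and smooth_fun_pd = smooth_fun_partial_derivatives[THEN conjunct2]

lemma pd_commute:
  assumes "smooth_fun f"
  shows "pd e (pd e' f) = pd e' (pd e f)"
proof
  fix z
  have ax: "(\<Sum>e\<in>UNIV. P e * axis e'' 1 $ e) = P e''" for P :: "'b \<Rightarrow> 'a" and e''
    by (simp add: axis_def if_distrib cong: if_cong)
  note f = smooth_fun_has_derivative[OF assms]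
  have "(\<Sum>e''\<in>UNIV. pd e'' (pd e f) z * axis e' 1 $ e'') = (\<Sum>e''\<in>UNIV. pd e'' (pd e' f) z * axis e 1 $ e'')"
    by (rule second_derivative_symmetric[OF f])
      (use smooth_fun_has_derivative[OF smooth_fun_pd[OF assms]] in \<open>simp_all only: ax\<close>)
  then show "pd e (pd e' f) z = pd e' (pd e f) z" by (simp only: ax)
qed

section \<open>Taylor coefficients along a path\<close>

text \<open>
  Differentiability of a fixed finite order suffices for the Leibniz rule and is, unlike the order
  infinity, established by a plain induction on the order.
\<close>

primrec diff_times :: "nat \<Rightarrow> ('k::real_normed_field \<Rightarrow> 'k) \<Rightarrow> bool" where
  "diff_times 0 f \<longleftrightarrow> True"
| "diff_times (Suc N) f \<longleftrightarrow> (\<exists>f'. (\<forall>x. (f has_field_derivative f' x) (at x)) \<and> diff_times N f')"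

lemma diff_times_Suc:
  "diff_times (Suc N) f \<longleftrightarrow> (\<forall>x. (f has_field_derivative deriv f x) (at x)) \<and> diff_times N (deriv f)"
proof -
  have "f' = deriv f" if "\<forall>x. (f has_field_derivative f' x) (at x)" for f'
    by (rule ext) (metis that DERIV_imp_deriv)
  then show ?thesis by auto
qed

lemma diff_times_SucD: "diff_times (Suc N) f \<Longrightarrow> diff_times N f"
  by (induction N arbitrary: f) auto

lemma diff_times_le: "k \<le> N \<Longrightarrow> diff_times N f \<Longrightarrow> diff_times k f"
  by (induction rule: inc_induct) (blast intro: diff_times_SucD)+

lemma diff_times_add: "diff_times N f \<Longrightarrow> diff_times N h \<Longrightarrow> diff_times N (\<lambda>x. f x + h x)"
proof (induction N arbitrary: f h)
  case (Suc N)
  then obtain f' h' where "\<forall>x. (f has_field_derivative f' x) (at x)" "diff_times N f'"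
    "\<forall>x. (h has_field_derivative h' x) (at x)" "diff_times N h'" by auto
  then show ?case using Suc.IH[of f' h']
    by (auto intro!: exI[of _ "\<lambda>x. f' x + h' x"] derivative_eq_intros)
qed simp

lemma diff_times_mult: "diff_times N f \<Longrightarrow> diff_times N h \<Longrightarrow> diff_times N (\<lambda>x. f x * h x)"
proof (induction N arbitrary: f h)
  case (Suc N)
  then obtain f' h' where 1: "\<forall>x. (f has_field_derivative f' x) (at x)" "diff_times N f'"
    "\<forall>x. (h has_field_derivative h' x) (at x)" "diff_times N h'" by auto
  have "diff_times N (\<lambda>x. f' x * h x + f x * h' x)"
    using 1 diff_times_SucD[OF Suc.prems(1)] diff_times_SucD[OF Suc.prems(2)]
    by (intro diff_times_add Suc.IH)
  then show ?case using 1
    by (auto intro!: exI[of _ "\<lambda>x. f' x * h x + f x * h' x"] derivative_eq_intros)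
qed simp

lemma diff_times_const: "diff_times N (\<lambda>x. a)"
  by (induction N arbitrary: a) (auto intro!: exI[of _ "\<lambda>x. 0"])

lemma diff_times_sum: "(\<And>i. i \<in> A \<Longrightarrow> diff_times N (f i)) \<Longrightarrow> diff_times N (\<lambda>x. \<Sum>i\<in>A. f i x)"
  by (induction A rule: infinite_finite_induct) (auto intro: diff_times_add diff_times_const)

lemma higher_deriv_add:
  assumes "diff_times N f" "diff_times N h"
  shows "(deriv ^^ N) (\<lambda>x. f x + h x) = (\<lambda>x. (deriv ^^ N) f x + (deriv ^^ N) h x)"
  using assms
proof (induction N arbitrary: f h)
  case (Suc N)
  have "deriv (\<lambda>x. f x + h x) = (\<lambda>x. deriv f x + deriv h x)"
    using Suc.prems unfolding diff_times_Suc
    by (intro ext DERIV_imp_deriv) (auto intro!: derivative_eq_intros)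
  then show ?case using Suc.IH[of "deriv f" "deriv h"] Suc.prems unfolding diff_times_Suc
    by (simp add: funpow_Suc_right del: funpow.simps)
qed simp

lemma higher_deriv_const_0: "(deriv ^^ N) (\<lambda>x. 0) = (\<lambda>x. 0)"
  by (induction N) (simp_all add: funpow_Suc_right del: funpow.simps)

lemma higher_deriv_sum:
  assumes "\<And>i. i \<in> A \<Longrightarrow> diff_times N (f i)"
  shows "(deriv ^^ N) (\<lambda>x. \<Sum>i\<in>A. f i x) = (\<lambda>x. \<Sum>i\<in>A. (deriv ^^ N) (f i) x)"
  using assms
  by (induction A rule: infinite_finite_induct)
    (auto simp: higher_deriv_const_0 higher_deriv_add diff_times_sum)

text \<open>
  The combinatorial core of every Leibniz rule: Pascal's triangle applied to a sum of two shifted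
  copies of the same sequence.
\<close>

lemma binomial_Suc_sum:
  fixes F :: "nat \<Rightarrow> 'a::comm_semiring_1"
  shows "(\<Sum>k\<le>N. of_nat (N choose k) * (F (Suc k) + F k)) = (\<Sum>k\<le>Suc N. of_nat (Suc N choose k) * F k)"
proof -
  have 1: "(\<Sum>k\<le>Suc N. of_nat (Suc N choose k) * F k)
      = F 0 + (\<Sum>k\<le>N. of_nat (N choose k) * F (Suc k)) + (\<Sum>k\<le>N. of_nat (N choose Suc k) * F (Suc k))"
    by (subst sum.atMost_Suc_shift) (simp add: algebra_simps sum.distrib)
  have "F 0 + (\<Sum>k\<le>N. of_nat (N choose Suc k) * F (Suc k)) = (\<Sum>k\<le>Suc N. of_nat (N choose k) * F k)"
    by (subst sum.atMost_Suc_shift) simp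
  also have "\<dots> = (\<Sum>k\<le>N. of_nat (N choose k) * F k)" by (simp add: binomial_eq_0)
  finally have 2: "F 0 + (\<Sum>k\<le>N. of_nat (N choose Suc k) * F (Suc k)) = (\<Sum>k\<le>N. of_nat (N choose k) * F k)" .
  show ?thesis
    unfolding 1 by (simp add: sum.distrib distrib_left flip: 2) (simp add: ac_simps)
qed

lemma higher_deriv_mult_Leibniz:
  assumes "diff_times N f" "diff_times N h"
  shows "(deriv ^^ N) (\<lambda>x. f x * h x) x = (\<Sum>k\<le>N. of_nat (N choose k) * ((deriv ^^ k) f x * (deriv ^^ (N - k)) h x))"
  using assms
proof (induction N arbitrary: f h)
  case (Suc N)
  have "deriv (\<lambda>x. f x * h x) = (\<lambda>x. deriv f x * h x + f x * deriv h x)"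
    using Suc.prems unfolding diff_times_Suc
    by (intro ext DERIV_imp_deriv) (auto intro!: derivative_eq_intros)
  then have "(deriv ^^ Suc N) (\<lambda>x. f x * h x) x = (deriv ^^ N) (\<lambda>x. deriv f x * h x) x + (deriv ^^ N) (\<lambda>x. f x * deriv h x) x"
    using Suc.prems diff_times_SucD[OF Suc.prems(1)] diff_times_SucD[OF Suc.prems(2)] unfolding diff_times_Suc
    by (simp add: funpow_Suc_right higher_deriv_add diff_times_mult del: funpow.simps)
  also have "\<dots> = (\<Sum>k\<le>N. of_nat (N choose k) * ((deriv ^^ Suc k) f x * (deriv ^^ (Suc N - Suc k)) h x +
        (deriv ^^ k) f x * (deriv ^^ (Suc N - k)) h x))"
    using Suc.prems diff_times_SucD[OF Suc.prems(1)] diff_times_SucD[OF Suc.prems(2)] unfolding diff_times_Suc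
    by (simp add: Suc.IH sum.distrib[symmetric] funpow_Suc_right Suc_diff_le distrib_left del: funpow.simps)
  also have "\<dots> = (\<Sum>k\<le>Suc N. of_nat (Suc N choose k) * ((deriv ^^ k) f x * (deriv ^^ (Suc N - k)) h x))"
    by (rule binomial_Suc_sum)
  finally show ?case .
qed simp

text \<open>
  The \<open>N\<close>-th derivative of \<open>f\<close> along a path with derivatives \<open>z 0, z 1, ...\<close>. The recursion is the
  chain rule \<open>(f \<circ> p)' = \<Sum>e. (\<partial>_e f \<circ> p) p_e'\<close> followed by the Leibniz rule for the
  \<open>N\<close>-th derivative of a product; it turns statements about higher chain rules into inductions on \<open>N\<close>.
\<close>

fun taylor_coeff :: "('k::{real_normed_field,euclidean_space}^'e \<Rightarrow> 'k) \<Rightarrow> nat \<Rightarrow> (nat \<Rightarrow> 'k^'e) \<Rightarrow> 'k" where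
  "taylor_coeff f 0 z = f (z 0)"
| "taylor_coeff f (Suc N) z = (\<Sum>e\<in>UNIV. \<Sum>k\<le>N. of_nat (N choose k) * (taylor_coeff (pd e f) (N - k) z * z (Suc k) $ e))"

lemma taylor_coeff_cong:
  "(\<And>s. s \<le> N \<Longrightarrow> z s = z' s) \<Longrightarrow> taylor_coeff f N z = taylor_coeff f N z'"
proof (induction N arbitrary: f rule: less_induct)
  case (less N)
  show ?case
  proof (cases N)
    case (Suc M)
    then show ?thesis using less by (auto intro!: sum.cong arg_cong2[where f="(*)"])
  qed (use less in auto)
qed

lemma compose_path_has_field_derivative:
  fixes f :: "'k::{real_normed_field,euclidean_space}^'e \<Rightarrow> 'k"
  assumes f: "smooth_fun f"
    and p: "\<And>e. ((\<lambda>\<epsilon>. p \<epsilon> $ e) has_field_derivative p' $ e) (at x)"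
  shows "((\<lambda>\<epsilon>. f (p \<epsilon>)) has_field_derivative (\<Sum>e\<in>UNIV. pd e f (p x) * p' $ e)) (at x)"
proof -
  have "(p has_derivative (\<lambda>t. \<chi> e. p' $ e * t)) (at x)"
  proof (subst has_derivative_componentwise_within, rule ballI)
    fix b :: "'k^'e" assume "b \<in> Basis"
    then obtain e u where b: "b = axis e u" by (auto simp: Basis_vec_def)
    have "((\<lambda>\<epsilon>. p \<epsilon> $ e \<bullet> u) has_derivative (\<lambda>t. (p' $ e * t) \<bullet> u)) (at x)"
      using p[of e] unfolding has_field_derivative_def
      by (rule has_derivative_inner_left)
    then show "((\<lambda>x. p x \<bullet> b) has_derivative (\<lambda>t. (\<chi> e. p' $ e * t) \<bullet> b)) (at x)"
      by (simp add: b inner_axis)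
  qed
  from has_derivative_compose[OF this smooth_fun_has_derivative[OF f]]
  show ?thesis unfolding has_field_derivative_def
    by (rule has_derivative_eq_rhs) (simp add: fun_eq_iff sum_distrib_right mult.assoc)
qed

lemma diff_times_compose_path:
  fixes f :: "'k::{real_normed_field,euclidean_space}^'e \<Rightarrow> 'k"
  assumes "smooth_fun f" and p: "\<And>e. diff_times N (\<lambda>\<epsilon>. p \<epsilon> $ e)"
  shows "diff_times N (\<lambda>\<epsilon>. f (p \<epsilon>))"
  using assms
proof (induction N arbitrary: f)
  case (Suc N)
  define p' where "p' = (\<lambda>x. \<chi> e. deriv (\<lambda>\<epsilon>. p \<epsilon> $ e) x)"
  have "((\<lambda>\<epsilon>. f (p \<epsilon>)) has_field_derivative (\<Sum>e\<in>UNIV. pd e f (p x) * p' x $ e)) (at x)" for x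
    using Suc.prems unfolding diff_times_Suc by (intro compose_path_has_field_derivative) (auto simp: p'_def)
  moreover have "diff_times N (\<lambda>x. \<Sum>e\<in>UNIV. pd e f (p x) * p' x $ e)"
  proof (intro diff_times_sum diff_times_mult)
    fix e :: 'e
    show "diff_times N (\<lambda>x. pd e f (p x))"
      by (rule Suc.IH[OF smooth_fun_pd[OF Suc.prems(1)] diff_times_SucD[OF Suc.prems(2)]])
    show "diff_times N (\<lambda>x. p' x $ e)"
      using Suc.prems(2)[of e] unfolding diff_times_Suc by (simp add: p'_def)
  qed
  ultimately show ?case
    by (auto intro!: exI[of _ "\<lambda>x. \<Sum>e\<in>UNIV. pd e f (p x) * p' x $ e"])
qed simp

lemma higher_deriv_compose_path:
  fixes f :: "'k::{real_normed_field,euclidean_space}^'e \<Rightarrow> 'k"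
  assumes "smooth_fun f" and p: "\<And>e. diff_times N (\<lambda>\<epsilon>. p \<epsilon> $ e)"
  shows "(deriv ^^ N) (\<lambda>\<epsilon>. f (p \<epsilon>)) x = taylor_coeff f N (\<lambda>s. \<chi> e. (deriv ^^ s) (\<lambda>\<epsilon>. p \<epsilon> $ e) x)"
  using assms
proof (induction N arbitrary: f rule: less_induct)
  case (less N)
  show ?case
  proof (cases N)
    case [simp]: (Suc M)
    have pM: "diff_times k (\<lambda>\<epsilon>. p \<epsilon> $ e)" if "k \<le> N" for k e
      using diff_times_le[OF that less.prems(2)] .
    define p' where "p' = (\<lambda>x. \<chi> e. deriv (\<lambda>\<epsilon>. p \<epsilon> $ e) x)"
    have comp: "diff_times M (\<lambda>x. pd e f (p x))" for e
      by (rule diff_times_compose_path[OF smooth_fun_pd[OF less.prems(1)] pM]) simp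
    have dp: "diff_times M (\<lambda>x. deriv (\<lambda>\<epsilon>. p \<epsilon> $ e) x)" for e
      using less.prems(2)[of e] unfolding Suc diff_times_Suc by simp
    have "deriv (\<lambda>\<epsilon>. f (p \<epsilon>)) = (\<lambda>x. \<Sum>e\<in>UNIV. deriv (\<lambda>\<epsilon>. p \<epsilon> $ e) x * pd e f (p x))"
    proof (intro ext DERIV_imp_deriv)
      fix x
      have "((\<lambda>\<epsilon>. p \<epsilon> $ e) has_field_derivative p' x $ e) (at x)" for e
        using less.prems(2)[of e] unfolding Suc diff_times_Suc by (simp add: p'_def)
      from compose_path_has_field_derivative[OF less.prems(1) this]
      show "((\<lambda>\<epsilon>. f (p \<epsilon>)) has_field_derivative (\<Sum>e\<in>UNIV. deriv (\<lambda>\<epsilon>. p \<epsilon> $ e) x * pd e f (p x))) (at x)"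
        by (rule DERIV_cong) (simp add: p'_def mult.commute)
    qed
    then have "(deriv ^^ N) (\<lambda>\<epsilon>. f (p \<epsilon>)) x = (deriv ^^ M) (\<lambda>x. \<Sum>e\<in>UNIV. deriv (\<lambda>\<epsilon>. p \<epsilon> $ e) x * pd e f (p x)) x"
      by (simp add: funpow_Suc_right del: funpow.simps)
    also have "\<dots> = (\<Sum>e\<in>UNIV. (deriv ^^ M) (\<lambda>x. deriv (\<lambda>\<epsilon>. p \<epsilon> $ e) x * pd e f (p x)) x)"
      by (subst higher_deriv_sum) (auto intro: diff_times_mult comp dp)
    also have "\<dots> = (\<Sum>e\<in>UNIV. \<Sum>k\<le>M. of_nat (M choose k) * ((deriv ^^ Suc k) (\<lambda>\<epsilon>. p \<epsilon> $ e) x *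
        (deriv ^^ (M - k)) (\<lambda>x. pd e f (p x)) x))"
      by (simp add: higher_deriv_mult_Leibniz[OF dp comp] funpow_Suc_right del: funpow.simps)
    also have "\<dots> = taylor_coeff f N (\<lambda>s. \<chi> e. (deriv ^^ s) (\<lambda>\<epsilon>. p \<epsilon> $ e) x)"
    proof -
      have "(deriv ^^ (M - k)) (\<lambda>x. pd e f (p x)) x = taylor_coeff (pd e f) (M - k) (\<lambda>s. \<chi> e. (deriv ^^ s) (\<lambda>\<epsilon>. p \<epsilon> $ e) x)" for k e
        by (rule less.IH[OF _ smooth_fun_pd[OF less.prems(1)] pM]) auto
      then show ?thesis by (simp add: mult.commute del: funpow.simps)
    qed
    finally show ?thesis .
  qed (use less in \<open>simp add: vec_lambda_unique\<close>)
qed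

section \<open>Variation of the Taylor coefficients\<close>

lemma sum_triangle_swap:
  fixes A :: "nat \<Rightarrow> nat \<Rightarrow> 'a::comm_monoid_add"
  shows "(\<Sum>k\<le>M. \<Sum>s\<le>M - k. A k s) = (\<Sum>s\<le>M. \<Sum>k\<le>M - s. A k s)"
  by (subst (1 2) sum.Sigma; simp?)
    (rule sum.reindex_bij_witness[of _ "\<lambda>(x, y). (y, x)" "\<lambda>(x, y). (y, x)"]; auto)

lemma choose_choose_swap:
  assumes "k + s \<le> (M::nat)"
  shows "(M choose k) * (M - k choose s) = (M choose s) * (M - s choose k)"
  using choose_mult[of k "k + s" M] choose_mult[of s "k + s" M] assms
    binomial_symmetric[of k "k + s"] by simp

text \<open>
  Formally, \<open>d/d\<tau> f(z(\<epsilon>) + \<tau> w(\<epsilon>))\<close> is \<open>\<Sum>e. (\<partial>_e f)(z(\<epsilon>) + \<tau> w(\<epsilon>)) w_e(\<epsilon>)\<close>, and the Leibniz rule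
  gives its \<open>\<epsilon>\<close>-derivatives. In the inductive step the variation hits either a partial
  derivative of \<open>f\<close> or the factor \<open>z (Suc k) $ e\<close>. The terms of the first kind recombine to Taylor
  coefficients of \<open>\<partial>_{e'} f\<close> because \<open>\<partial>_e\<close> and \<open>\<partial>_{e'}\<close> commute; the two
  kinds add up by Pascal's rule.
\<close>

lemma taylor_coeff_variation:
  fixes f :: "'k::{real_normed_field,euclidean_space}^'e \<Rightarrow> 'k"
  assumes "smooth_fun f"
  shows "((\<lambda>\<tau>. taylor_coeff f N (\<lambda>s. z s + \<tau> *s w s)) has_field_derivative
    (\<Sum>e\<in>UNIV. \<Sum>s\<le>N. of_nat (N choose s) * (taylor_coeff (pd e f) (N - s) (\<lambda>s. z s + \<tau> *s w s) * w s $ e))) (at \<tau>)"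
  using assms
proof (induction N arbitrary: f rule: less_induct)
  case (less N)
  show ?case
  proof (cases N)
    case 0
    have "((\<lambda>\<tau>. (z 0 + \<tau> *s w 0) $ e) has_field_derivative w 0 $ e) (at \<tau>)" for e
      by (auto intro!: derivative_eq_intros)
    from compose_path_has_field_derivative[OF less.prems this] show ?thesis
      by (simp add: 0)
  next
    case (Suc M)
    define Z where "Z = (\<lambda>s. z s + \<tau> *s w s)"
    define B where "B = (\<lambda>e k. \<Sum>e'\<in>UNIV. \<Sum>s\<le>M - k. of_nat (M - k choose s) * (taylor_coeff (pd e' (pd e f)) (M - k - s) Z * w s $ e'))"
    have IH: "((\<lambda>\<tau>. taylor_coeff (pd e f) (M - k) (\<lambda>s. z s + \<tau> *s w s)) has_field_derivative B e k) (at \<tau>)" for e k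
      unfolding B_def Z_def by (rule less.IH) (use Suc smooth_fun_pd[OF less.prems] in auto)
    have "((\<lambda>\<tau>. taylor_coeff f N (\<lambda>s. z s + \<tau> *s w s)) has_field_derivative
       (\<Sum>e\<in>UNIV. \<Sum>k\<le>M. of_nat (M choose k) * (B e k * Z (Suc k) $ e + taylor_coeff (pd e f) (M - k) Z * w (Suc k) $ e))) (at \<tau>)"
      unfolding Suc taylor_coeff.simps
      by (auto intro!: derivative_eq_intros IH simp: Z_def algebra_simps)
    also have "(\<Sum>e\<in>UNIV. \<Sum>k\<le>M. of_nat (M choose k) * (B e k * Z (Suc k) $ e + taylor_coeff (pd e f) (M - k) Z * w (Suc k) $ e))
      = (\<Sum>e\<in>UNIV. \<Sum>k\<le>M. of_nat (M choose k) * (B e k * Z (Suc k) $ e)) +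
        (\<Sum>e\<in>UNIV. \<Sum>k\<le>M. of_nat (M choose k) * (taylor_coeff (pd e f) (M - k) Z * w (Suc k) $ e))"
      by (simp add: sum.distrib distrib_left)
    also have "(\<Sum>e\<in>UNIV. \<Sum>k\<le>M. of_nat (M choose k) * (B e k * Z (Suc k) $ e)) =
      (\<Sum>e\<in>UNIV. \<Sum>e'\<in>UNIV. \<Sum>k\<le>M. \<Sum>s\<le>M - k. of_nat ((M choose k) * (M - k choose s)) *
         (taylor_coeff (pd e' (pd e f)) (M - k - s) Z * w s $ e' * Z (Suc k) $ e))"
      unfolding B_def sum_distrib_left sum_distrib_right
      by (subst sum.swap[of _ UNIV "{..M}"]) (simp add: mult_ac)
    also have "\<dots> = (\<Sum>e'\<in>UNIV. \<Sum>e\<in>UNIV. \<Sum>s\<le>M. \<Sum>k\<le>M - s. of_nat ((M choose k) * (M - k choose s)) *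
         (taylor_coeff (pd e' (pd e f)) (M - k - s) Z * w s $ e' * Z (Suc k) $ e))"
      by (subst sum.swap, rule sum.cong[OF refl], rule sum.cong[OF refl], rule sum_triangle_swap)
    also have "\<dots> = (\<Sum>e'\<in>UNIV. \<Sum>s\<le>M. \<Sum>e\<in>UNIV. \<Sum>k\<le>M - s. of_nat ((M choose s) * (M - s choose k)) *
         (taylor_coeff (pd e (pd e' f)) (M - s - k) Z * w s $ e' * Z (Suc k) $ e))"
    proof (rule sum.cong[OF refl], subst (2) sum.swap, intro sum.cong refl)
      fix e' e s k assume "s \<in> {..M}" "k \<in> {..M - s}"
      then have "k + s \<le> M" by auto
      then show "of_nat ((M choose k) * (M - k choose s)) * (taylor_coeff (pd e' (pd e f)) (M - k - s) Z * w s $ e' * Z (Suc k) $ e)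
        = of_nat ((M choose s) * (M - s choose k)) * (taylor_coeff (pd e (pd e' f)) (M - s - k) Z * w s $ e' * Z (Suc k) $ e)"
        unfolding choose_choose_swap[OF \<open>k + s \<le> M\<close>] pd_commute[OF less.prems, of e' e]
        by (simp only: diff_diff_left add.commute)
    qed
    also have "\<dots> = (\<Sum>e\<in>UNIV. \<Sum>s\<le>M. of_nat (M choose s) * (taylor_coeff (pd e f) (Suc M - s) Z * w s $ e))"
      by (simp add: Suc_diff_le sum_distrib_left sum_distrib_right mult_ac)
    also have "\<dots> + (\<Sum>e\<in>UNIV. \<Sum>k\<le>M. of_nat (M choose k) * (taylor_coeff (pd e f) (M - k) Z * w (Suc k) $ e)) =
      (\<Sum>e\<in>UNIV. \<Sum>k\<le>M. of_nat (M choose k) * (taylor_coeff (pd e f) (Suc M - Suc k) Z * w (Suc k) $ e + taylor_coeff (pd e f) (Suc M - k) Z * w k $ e))"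
      by (simp add: sum.distrib distrib_left add.commute)
    also have "\<dots> = (\<Sum>e\<in>UNIV. \<Sum>s\<le>N. of_nat (N choose s) * (taylor_coeff (pd e f) (N - s) Z * w s $ e))"
      unfolding Suc by (intro sum.cong refl binomial_Suc_sum)
    finally show ?thesis unfolding Z_def .
  qed
qed

lemma constant_derivative_imp_increment:
  fixes \<phi> :: "'k::real_normed_field \<Rightarrow> 'k"
  assumes "\<And>\<tau>. (\<phi> has_field_derivative C) (at \<tau>)"
  shows "\<phi> 1 = \<phi> 0 + C"
proof -
  have "((\<lambda>\<tau>. \<phi> \<tau> - \<tau> * C) has_field_derivative 0) (at \<tau>)" for \<tau>
    using assms by (auto intro!: derivative_eq_intros)
  then obtain c where "\<And>\<tau>. \<phi> \<tau> - \<tau> * C = c"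
    using has_field_derivative_zero_constant[of UNIV "\<lambda>\<tau>. \<phi> \<tau> - \<tau> * C"] by auto
  from this[of 1] this[of 0] show ?thesis by (simp add: diff_eq_eq)
qed

text \<open>
  Along the segment from \<open>z'\<close> to \<open>z\<close> the derivative given by the variation formula is constant: a
  term with \<open>w s \<noteq> 0\<close> has \<open>s > k + l\<close>, hence involves a Taylor coefficient of order \<open>N - s \<le> k\<close>,
  which depends only on entries where \<open>z\<close> and \<open>z'\<close> agree. So the increment is the derivative.
\<close>

lemma taylor_coeff_top_linear:
  fixes f :: "'k::{real_normed_field,euclidean_space}^'e \<Rightarrow> 'k"
  assumes f: "smooth_fun f" and agree: "\<And>s. s \<le> k + l \<Longrightarrow> z s = z' s" and N: "N = 2 * k + 1 + l"
  shows "taylor_coeff f N z = taylor_coeff f N z' +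
    (\<Sum>e\<in>UNIV. \<Sum>t\<le>k. of_nat (N choose t) * (taylor_coeff (pd e f) t z * (z (N - t) - z' (N - t)) $ e))"
proof -
  define w where "w = (\<lambda>s. z s - z' s)"
  define C where "C = (\<Sum>e\<in>UNIV. \<Sum>s\<le>N. of_nat (N choose s) * (taylor_coeff (pd e f) (N - s) z * w s $ e))"
  have "((\<lambda>\<tau>. taylor_coeff f N (\<lambda>s. z' s + \<tau> *s w s)) has_field_derivative C) (at \<tau>)" for \<tau>
  proof -
    have "taylor_coeff (pd e f) (N - s) (\<lambda>s. z' s + \<tau> *s w s) * w s $ e = taylor_coeff (pd e f) (N - s) z * w s $ e" for e s
    proof (cases "s \<le> k + l")
      case True
      then show ?thesis by (simp add: w_def agree)
    next
      case False
      then have "N - s \<le> k" using N by simp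
      then have "taylor_coeff (pd e f) (N - s) (\<lambda>s. z' s + \<tau> *s w s) = taylor_coeff (pd e f) (N - s) z"
        by (intro taylor_coeff_cong) (simp add: w_def agree)
      then show ?thesis by simp
    qed
    then show ?thesis unfolding C_def using taylor_coeff_variation[OF f, of N z' w \<tau>] by (simp only:)
  qed
  from constant_derivative_imp_increment[OF this]
  have "taylor_coeff f N z = taylor_coeff f N z' + C" by (simp add: w_def)
  also have "C = (\<Sum>e\<in>UNIV. \<Sum>t\<le>k. of_nat (N choose t) * (taylor_coeff (pd e f) t z * w (N - t) $ e))"
    unfolding C_def
  proof (rule sum.cong[OF refl])
    fix e :: 'e
    have "(\<Sum>s\<le>N. of_nat (N choose s) * (taylor_coeff (pd e f) (N - s) z * w s $ e))
      = (\<Sum>t\<le>N. of_nat (N choose t) * (taylor_coeff (pd e f) t z * w (N - t) $ e))"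
      by (rule sum.reindex_bij_witness[of _ "\<lambda>t. N - t" "\<lambda>s. N - s"]) (auto simp: binomial_symmetric[symmetric])
    also have "\<dots> = (\<Sum>t\<le>k. of_nat (N choose t) * (taylor_coeff (pd e f) t z * w (N - t) $ e))"
      by (rule sum.mono_neutral_right) (auto simp: w_def agree N)
    finally show "(\<Sum>s\<le>N. of_nat (N choose s) * (taylor_coeff (pd e f) (N - s) z * w s $ e))
      = (\<Sum>t\<le>k. of_nat (N choose t) * (taylor_coeff (pd e f) t z * w (N - t) $ e))" .
  qed
  finally show ?thesis by (simp add: w_def)
qed

lemma polynomial_fun_sum:
  "(\<And>i. i \<in> A \<Longrightarrow> polynomial_fun I (f i)) \<Longrightarrow> polynomial_fun I (\<lambda>v. \<Sum>i\<in>A. f i v)"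
  by (induction A rule: infinite_finite_induct) (auto intro: polynomial_fun.intros)

text \<open>
  The entry at 0 must be kept fixed: there the dependence is that of \<open>f\<close> and its partial derivatives,
  whereas the other entries enter the recursion only through products.
\<close>

lemma taylor_coeff_polynomial:
  assumes "\<And>v. z v 0 = z0" and "\<And>s e. polynomial_fun I (\<lambda>v. z v (Suc s) $ e)"
  shows "polynomial_fun I (\<lambda>v. taylor_coeff f N (z v))"
proof (induction N arbitrary: f rule: less_induct)
  case (less N)
  show ?case
    by (cases N) (auto simp: assms(1) intro!: polynomial_fun_sum polynomial_fun.const polynomial_fun.mult
      assms(2) less.IH)
qed
section \<open>The expansion coefficients of the system\<close>

text \<open>
  The space \<open>K \<times> (K^d)^(n+1)\<close> and its coordinate space: \<open>None\<close> indexes \<open>x\<close>, and \<open>Some (j, a)\<close> indexes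
  component \<open>a\<close> of \<open>y_j\<close>.
\<close>

definition coords :: "'k \<times> (('k^'d)^'j) \<Rightarrow> 'k^(('j \<times> 'd) option)" where
  "coords z = (\<chi> e. case e of None \<Rightarrow> fst z | Some (j, a) \<Rightarrow> snd z $ j $ a)"

definition point :: "'k^(('j \<times> 'd) option) \<Rightarrow> 'k \<times> (('k^'d)^'j)" where
  "point u = (u $ None, \<chi> j a. u $ Some (j, a))"

lemma coords_nth [simp]: "coords z $ None = fst z" "coords z $ Some (j, a) = snd z $ j $ a"
  by (simp_all add: coords_def)

lemma point_nth [simp]: "fst (point u) = u $ None" "snd (point u) $ j $ a = u $ Some (j, a)"
  by (simp_all add: point_def)

lemma kscale_nth [simp]: "fst (kscale a z) = a * fst z" "snd (kscale a z) $ j $ b = a * snd z $ j $ b"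
  by (simp_all add: kscale_def)

lemma point_coords [simp]: "point (coords z) = z"
  by (simp add: point_def prod_eq_iff vec_eq_iff)

lemma sum_UNIV_option:
  fixes f :: "('a::finite) option \<Rightarrow> 'b::comm_monoid_add"
  shows "(\<Sum>e\<in>UNIV. f e) = f None + (\<Sum>x\<in>UNIV. f (Some x))"
  by (simp add: UNIV_option_conv sum.reindex)

lemma C_infinity_derivative:
  assumes "C_infinity G"
  shows "\<exists>G'. (\<forall>z. (G has_derivative G' z) (at z)) \<and> (\<forall>z a v. G' z (kscale a v) = a *s G' z v) \<and>
    (\<forall>v. C_infinity (\<lambda>z. G' z v))"
proof -
  define G' where "G' = (\<lambda>z. frechet_derivative G (at z))"
  have *: "(G has_derivative G' z) (at z) \<and> (\<forall>a v. G' z (kscale a v) = a *s G' z v) \<and> Ck r (\<lambda>z. G' z v)" for z r v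
  proof -
    have "Ck (Suc r) G" using assms by (simp add: C_infinity_def)
    then obtain G'' where G'': "\<forall>z. (G has_derivative G'' z) (at z) \<and> (\<forall>a v. G'' z (kscale a v) = a *s G'' z v)"
      "\<forall>v. Ck r (\<lambda>z. G'' z v)" by auto
    have "G'' z = G' z" for z unfolding G'_def by (rule frechet_derivative_at) (use G'' in blast)
    then have "G'' = G'" by blast
    then show ?thesis using G'' by blast
  qed
  show ?thesis by (rule exI[of _ G']) (use * in \<open>auto simp: C_infinity_def\<close>)
qed

lemma point_expansion:
  "point v = (\<Sum>e\<in>UNIV. kscale (v $ e) (point (axis e 1)))"
  by (simp add: prod_eq_iff vec_eq_iff fst_sum snd_sum axis_def mult_delta_right)

lemma bounded_linear_point:
  "bounded_linear (point :: ('k::{real_normed_field,euclidean_space})^(('j::finite \<times> 'd::finite) option) \<Rightarrow> _)"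
  unfolding linear_conv_bounded_linear[symmetric]
  by (auto intro!: linearI simp: point_def vec_eq_iff)

lemma smooth_fun_component:
  fixes G :: "'k::{real_normed_field,euclidean_space} \<times> (('k^'d)^'j) \<Rightarrow> 'k^'d"
  assumes "C_infinity G"
  shows "smooth_fun (\<lambda>u. G (point u) $ a)"
proof (coinduct rule: smooth_fun.coinduct[where X="\<lambda>f. \<exists>G::'k \<times> (('k^'d)^'j) \<Rightarrow> 'k^'d. C_infinity G \<and> f = (\<lambda>u. G (point u) $ a)"])
  show "\<exists>G'. C_infinity G' \<and> (\<lambda>u. G (point u) $ a) = (\<lambda>u. G' (point u) $ a)"
    by (intro exI[of _ G] conjI assms refl)
next
  fix f :: "'k^(('j \<times> 'd) option) \<Rightarrow> 'k"
  assume "\<exists>G::'k \<times> (('k^'d)^'j) \<Rightarrow> 'k^'d. C_infinity G \<and> f = (\<lambda>u. G (point u) $ a)"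
  then obtain G :: "'k \<times> (('k^'d)^'j) \<Rightarrow> 'k^'d" where ex_G: "C_infinity G \<and> f = (\<lambda>u. G (point u) $ a)" ..
  note G = ex_G[THEN conjunct1] ex_G[THEN conjunct2]
  from C_infinity_derivative[OF G(1)] obtain G' where
    ex: "(\<forall>z. (G has_derivative G' z) (at z)) \<and> (\<forall>z a v. G' z (kscale a v) = a *s G' z v) \<and> (\<forall>v. C_infinity (\<lambda>z. G' z v))" ..
  have G': "(G has_derivative G' z) (at z)" for z using ex[THEN conjunct1] ..
  have G'_scale: "G' z (kscale a v) = a *s G' z v" for z a v
    by (rule ex[THEN conjunct2, THEN conjunct1, rule_format])
  have G'_smooth: "C_infinity (\<lambda>z. G' z v)" for v using ex[THEN conjunct2, THEN conjunct2] ..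
  define D where "D = (\<lambda>e u. G' (point u) (point (axis e 1)) $ a)"
  have "(f has_derivative (\<lambda>v. \<Sum>e\<in>UNIV. D e z * v $ e)) (at z)" for z
  proof -
    have "(point has_derivative point) (at z)"
      by (rule bounded_linear_imp_has_derivative[OF bounded_linear_point])
    from has_derivative_compose[OF this G']
    have 1: "((\<lambda>u. G (point u)) has_derivative (\<lambda>v. G' (point z) (point v))) (at z)" .
    have 2: "((\<lambda>u. G (point u) $ a) has_derivative (\<lambda>v. G' (point z) (point v) $ a)) (at z)"
      by (rule bounded_linear.has_derivative[OF bounded_linear_vec_nth 1])
    have 3: "G' (point z) (point v) $ a = (\<Sum>e\<in>UNIV. D e z * v $ e)" for v
      by (subst point_expansion)
        (simp add: linear_sum[OF has_derivative_linear[OF G']] G'_scale D_def mult.commute)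
    show ?thesis using 2 unfolding 3 G(2) .
  qed
  moreover have "\<exists>G::'k \<times> (('k^'d)^'j) \<Rightarrow> 'k^'d. C_infinity G \<and> D e = (\<lambda>u. G (point u) $ a)" for e
    unfolding D_def by (intro exI[of _ "\<lambda>z. G' z (point (axis e 1))"] conjI G'_smooth refl)
  ultimately show "\<exists>f' D. f = f' \<and> (\<forall>z. (f' has_derivative (\<lambda>v. \<Sum>e\<in>UNIV. D e z * v $ e)) (at z)) \<and>
      (\<forall>e. (\<exists>G::'k \<times> (('k^'d)^'j) \<Rightarrow> 'k^'d. C_infinity G \<and> D e = (\<lambda>u. G (point u) $ a)) \<or> smooth_fun (D e))"
    by (intro exI[of _ f] exI[of _ D] conjI allI refl disjI1)
qed

text \<open>
  Polynomial paths with prescribed derivatives at 0; differentiation shifts the coefficients.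
\<close>

lemma taylor_sum_has_derivative:
  "((\<lambda>\<epsilon>. \<Sum>s\<le>N. b s * (\<epsilon> ^ s / fact s)) has_field_derivative
     (\<Sum>s<N. b (Suc s) * (x ^ s / fact s))) (at (x :: 'k::real_normed_field))"
proof (induction N)
  case (Suc N)
  have "((\<lambda>\<epsilon>. b (Suc N) / fact (Suc N) * \<epsilon> ^ Suc N) has_field_derivative
      b (Suc N) / fact (Suc N) * (of_nat (Suc N) * x ^ N)) (at x)"
    by (rule DERIV_cong[OF DERIV_cmult[OF DERIV_power_Suc[OF DERIV_ident]]]) simp
  moreover have "b (Suc N) / fact (Suc N) * (of_nat (Suc N) * x ^ N) = b (Suc N) * (x ^ N / fact N)"
    using of_nat_neq_0[of N, where 'a='k] by (simp del: of_nat_Suc)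
  ultimately have "((\<lambda>\<epsilon>. b (Suc N) * (\<epsilon> ^ Suc N / fact (Suc N))) has_field_derivative b (Suc N) * (x ^ N / fact N)) (at x)"
    by simp
  from DERIV_add[OF Suc this] show ?case by simp
qed simp

lemma higher_deriv_taylor_sum:
  fixes b :: "nat \<Rightarrow> 'k::real_normed_field"
  shows "diff_times k (\<lambda>\<epsilon>. \<Sum>s<M. b s * (\<epsilon> ^ s / fact s)) \<and>
    (k < M \<longrightarrow> (deriv ^^ k) (\<lambda>\<epsilon>. \<Sum>s<M. b s * (\<epsilon> ^ s / fact s)) 0 = b k)"
proof (induction k arbitrary: b M)
  case 0
  then show ?case by (cases M) (simp_all add: sum.lessThan_Suc_shift del: sum.lessThan_Suc)
next
  case (Suc k)
  show ?case
  proof (cases M)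
    case 0
    then show ?thesis using diff_times_const[of "Suc k" 0] by simp
  next
    case [simp]: (Suc N)
    have 1: "((\<lambda>\<epsilon>. \<Sum>s<M. b s * (\<epsilon> ^ s / fact s)) has_field_derivative
     (\<Sum>s<N. b (Suc s) * (x ^ s / fact s))) (at x)" for x
      using taylor_sum_has_derivative[of b N x] by (simp add: lessThan_Suc_atMost)
    then have "deriv (\<lambda>\<epsilon>. \<Sum>s<M. b s * (\<epsilon> ^ s / fact s)) = (\<lambda>x. \<Sum>s<N. b (Suc s) * (x ^ s / fact s))"
      by (intro ext DERIV_imp_deriv)
    then show ?thesis using Suc.IH[of "\<lambda>s. b (Suc s)" N] 1
      unfolding diff_times_Suc by (simp add: funpow_Suc_right del: funpow.simps sum.lessThan_Suc)
  qed
qed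

lemma T_eq_taylor_coeff:
  fixes G :: "'k::{real_normed_field,euclidean_space} \<times> (('k^'d)^'j) \<Rightarrow> 'k^'d"
  assumes "C_infinity G"
  shows "T G N z $ a = taylor_coeff (\<lambda>u. G (point u) $ a) N (\<lambda>s. coords (z s))"
proof -
  define p where "p = (\<lambda>\<epsilon>::'k. \<chi> e. \<Sum>s<Suc N. coords (z s) $ e * (\<epsilon> ^ s / fact s))"
  have "(\<Sum>s\<le>N. kscale (\<epsilon> ^ s / fact s) (z s)) = point (p \<epsilon>)" for \<epsilon>
    by (auto simp: p_def point_def kscale_def prod_eq_iff vec_eq_iff fst_sum snd_sum mult.commute lessThan_Suc_atMost)
  then have "T G N z $ a = (deriv ^^ N) (\<lambda>\<epsilon>. G (point (p \<epsilon>)) $ a) 0"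
    by (simp add: T_def)
  also have "\<dots> = taylor_coeff (\<lambda>u. G (point u) $ a) N (\<lambda>s. \<chi> e. (deriv ^^ s) (\<lambda>\<epsilon>. p \<epsilon> $ e) 0)"
    by (rule higher_deriv_compose_path[OF smooth_fun_component[OF assms]])
      (simp add: p_def higher_deriv_taylor_sum del: sum.lessThan_Suc times_divide_eq_right)
  also have "\<dots> = taylor_coeff (\<lambda>u. G (point u) $ a) N (\<lambda>s. coords (z s))"
    by (rule taylor_coeff_cong) (simp add: p_def higher_deriv_taylor_sum vec_eq_iff del: sum.lessThan_Suc times_divide_eq_right)
  finally show ?thesis .
qed

text \<open>
  The variation formula for a direction concentrated at the index \<open>i\<close>. Writing the result as a sum over
  all \<open>j\<close> with a side condition covers the values of \<open>J\<close> which no index \<open>j\<close> represents; there both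
  sides vanish.
\<close>

lemma T_y_eq_taylor_coeff:
  fixes G :: "'k::{real_normed_field,euclidean_space} \<times> (('k^'d)^('j::{finite,linorder})) \<Rightarrow> 'k^'d"
  assumes "C_infinity G"
  shows "T_y G i J z $ a $ b = (\<Sum>j\<in>UNIV. if int (idx j) = J
    then of_nat (2 * i choose i) * taylor_coeff (pd (Some (j, b)) (\<lambda>u. G (point u) $ a)) i (\<lambda>s. coords (z s)) else 0)"
proof (cases "J < 0")
  case True
  then show ?thesis by (auto simp: T_y_def intro!: sum.neutral[symmetric])
next
  case False
  define f where "f = (\<lambda>u. G (point u) $ a)"
  define w :: "nat \<Rightarrow> 'k^(('j \<times> 'd) option)" where
    "w = (\<lambda>s. if s = i then (\<chi> e. case e of None \<Rightarrow> 0 | Some (j, b') \<Rightarrow> if int (idx j) = J \<and> b' = b then 1 else 0) else 0)"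
  have "coords ((z(i := z i + (0, \<chi> j'. if int (idx j') = J then axis b \<tau> else 0))) s) = coords (z s) + \<tau> *s w s" for \<tau> s
    by (auto simp: vec_eq_iff w_def axis_def coords_def split: option.splits)
  then have "T G (2 * i) (z(i := z i + (0, \<chi> j'. if int (idx j') = J then axis b \<tau> else 0))) $ a
    = taylor_coeff f (2 * i) (\<lambda>s. coords (z s) + \<tau> *s w s)" for \<tau>
    by (simp only: T_eq_taylor_coeff[OF assms] f_def)
  then have "T_y G i J z $ a $ b = deriv (\<lambda>\<tau>. taylor_coeff f (2 * i) (\<lambda>s. coords (z s) + \<tau> *s w s)) 0"
    using False by (simp add: T_y_def)
  also have "\<dots> = (\<Sum>e\<in>UNIV. \<Sum>s\<le>2 * i. of_nat (2 * i choose s) * (taylor_coeff (pd e f) (2 * i - s) (\<lambda>s. coords (z s)) * w s $ e))"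
    using DERIV_imp_deriv[OF taylor_coeff_variation[of f "2 * i" "\<lambda>s. coords (z s)" w 0]] smooth_fun_component[OF assms, of a]
    by (simp add: f_def)
  also have "\<dots> = (\<Sum>e\<in>UNIV. of_nat (2 * i choose i) * (taylor_coeff (pd e f) i (\<lambda>s. coords (z s)) * w i $ e))"
  proof (rule sum.cong[OF refl])
    fix e
    have "(\<Sum>s\<le>2 * i. of_nat (2 * i choose s) * (taylor_coeff (pd e f) (2 * i - s) (\<lambda>s. coords (z s)) * w s $ e))
      = (\<Sum>s\<in>{i}. of_nat (2 * i choose s) * (taylor_coeff (pd e f) (2 * i - s) (\<lambda>s. coords (z s)) * w s $ e))"
      by (rule sum.mono_neutral_right) (auto simp: w_def)
    then show "(\<Sum>s\<le>2 * i. of_nat (2 * i choose s) * (taylor_coeff (pd e f) (2 * i - s) (\<lambda>s. coords (z s)) * w s $ e))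
      = of_nat (2 * i choose i) * (taylor_coeff (pd e f) i (\<lambda>s. coords (z s)) * w i $ e)" by simp
  qed
  also have "\<dots> = (\<Sum>(j, b')\<in>UNIV. if int (idx j) = J \<and> b' = b
    then of_nat (2 * i choose i) * taylor_coeff (pd (Some (j, b')) f) i (\<lambda>s. coords (z s)) else 0)"
    by (subst sum_UNIV_option) (auto simp: w_def intro!: sum.cong)
  also have "\<dots> = (\<Sum>j\<in>UNIV. \<Sum>b'\<in>UNIV. if int (idx j) = J \<and> b' = b
    then of_nat (2 * i choose i) * taylor_coeff (pd (Some (j, b')) f) i (\<lambda>s. coords (z s)) else 0)"
    by (subst sum.cartesian_product) simp
  also have "\<dots> = (\<Sum>j\<in>UNIV. if int (idx j) = J
    then of_nat (2 * i choose i) * taylor_coeff (pd (Some (j, b)) f) i (\<lambda>s. coords (z s)) else 0)"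
    by (intro sum.cong refl) (auto simp: if_distrib cong: if_cong)
  finally show ?thesis unfolding f_def .
qed
section \<open>Splitting off the highest coefficients\<close>

lemma idx_le: "CARD('j::{finite,linorder}) = n + 1 \<Longrightarrow> idx (j :: 'j) \<le> n"
  unfolding idx_def using psubset_card_mono[of "UNIV :: 'j set" "{..<j}"] by fastforce

definition truncate_seq :: "nat \<Rightarrow> (nat \<Rightarrow> 'a::zero) \<Rightarrow> nat \<Rightarrow> 'a" where
  "truncate_seq M c i = (if i \<le> M then c i else 0)"

lemma \<gamma>_mult_central_binomial:
  "\<gamma> k l t * of_nat (2 * t choose t) = (of_nat (2 * k + 1 + l choose t) :: 'a::field_char_0)"
  by (simp add: \<gamma>_def)

lemma sum_reverse3:
  "(\<Sum>s\<in>A. \<Sum>b\<in>B. \<Sum>j\<in>C. F s b j) = (\<Sum>j\<in>C. \<Sum>b\<in>B. \<Sum>s\<in>A. F s b j)"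
proof -
  have "(\<Sum>s\<in>A. \<Sum>b\<in>B. \<Sum>j\<in>C. F s b j) = (\<Sum>s\<in>A. \<Sum>j\<in>C. \<Sum>b\<in>B. F s b j)"
    by (rule sum.cong[OF refl], rule sum.swap)
  also have "\<dots> = (\<Sum>j\<in>C. \<Sum>s\<in>A. \<Sum>b\<in>B. F s b j)" by (rule sum.swap)
  also have "\<dots> = (\<Sum>j\<in>C. \<Sum>b\<in>B. \<Sum>s\<in>A. F s b j)"
    by (rule sum.cong[OF refl], rule sum.swap)
  finally show ?thesis .
qed

text \<open>
  Comparing the sequence with its truncation, \<open>taylor_coeff_top_linear\<close> leaves the
  terms \<open>binomial N t\<close> times a derivative of \<open>\<partial>G/\<partial>y_j\<close> of order \<open>t\<close> times \<open>c (N - t + idx j)\<close>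
  where \<open>N - t + idx j\<close> exceeds \<open>k + l + n\<close>. Numbering them by \<open>s = n + t - idx j\<close> instead of \<open>j\<close>
  turns the condition into \<open>s \<le> k\<close> and the sum into the block product \<open>\<Gamma>_k S_k\<close>.
\<close>

lemma T_splitting:
  fixes G :: "'k::{real_normed_field,euclidean_space} \<times> (('k^'d)^('j::{finite,linorder})) \<Rightarrow> 'k^'d"
  assumes G: "C_infinity G" and n: "CARD('j) = n + 1"
  shows "T G (2 * k + 1 + l) (subst_series c) =
    \<Gamma>S G n k l c + T G (2 * k + 1 + l) (subst_series (truncate_seq (k + l + n) c))"
proof (subst vec_eq_iff, rule allI)
  fix a :: 'd
  define f where "f = (\<lambda>u :: 'k^(('j \<times> 'd) option). G (point u) $ a)"
  define z :: "nat \<Rightarrow> 'k^(('j \<times> 'd) option)" where "z = (\<lambda>s. coords (subst_series c s))"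
  define z' :: "nat \<Rightarrow> 'k^(('j \<times> 'd) option)"
    where "z' = (\<lambda>s. coords (subst_series (truncate_seq (k + l + n) c) s))"
  define N where "N = 2 * k + 1 + l"
  note idx = idx_le[OF n]
  define X where "X = (\<lambda>j b t. of_nat (N choose t) * (taylor_coeff (pd (Some (j, b)) f) t z * c (N - t + idx j) $ b))"
  define Y where "Y = (\<Sum>j\<in>UNIV. \<Sum>b\<in>UNIV. \<Sum>t\<le>k. if n + t \<le> k + idx j then X j b t else 0)"
  have zs: "z s $ None = (if s = 1 then 1 else 0)" "z s $ Some (j, b) = c (s + idx j) $ b"
    "z' s $ None = (if s = 1 then 1 else 0)" "z' s $ Some (j, b) = truncate_seq (k + l + n) c (s + idx j) $ b" for s j b
    by (simp_all add: z_def z'_def subst_series_def)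
  have agree: "z s = z' s" if "s \<le> k + l" for s
  proof (subst vec_eq_iff, rule allI)
    fix e
    show "z s $ e = z' s $ e"
    proof (cases e)
      case (Some p)
      obtain j b where "p = (j, b)" by (cases p)
      moreover have "s + idx j \<le> k + l + n" using that idx[of j] by linarith
      ultimately show ?thesis by (simp add: Some zs truncate_seq_def)
    qed (simp add: zs)
  qed
  have "taylor_coeff f N z = taylor_coeff f N z' +
    (\<Sum>e\<in>UNIV. \<Sum>t\<le>k. of_nat (N choose t) * (taylor_coeff (pd e f) t z * (z (N - t) - z' (N - t)) $ e))"
    by (rule taylor_coeff_top_linear[OF _ agree N_def]) (simp add: f_def smooth_fun_component[OF G])
  also have "(\<Sum>e\<in>UNIV. \<Sum>t\<le>k. of_nat (N choose t) * (taylor_coeff (pd e f) t z * (z (N - t) - z' (N - t)) $ e)) =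
    (\<Sum>p\<in>UNIV. \<Sum>t\<le>k. of_nat (N choose t) * (taylor_coeff (pd (Some p) f) t z * (z (N - t) - z' (N - t)) $ Some p))"
    by (subst sum_UNIV_option) (simp add: zs)
  also have "\<dots> = (\<Sum>(j, b)\<in>UNIV. \<Sum>t\<le>k. of_nat (N choose t) * (taylor_coeff (pd (Some (j, b)) f) t z * (z (N - t) - z' (N - t)) $ Some (j, b)))"
    by (simp add: case_prod_unfold)
  also have "\<dots> = (\<Sum>j\<in>UNIV. \<Sum>b\<in>UNIV. \<Sum>t\<le>k. of_nat (N choose t) * (taylor_coeff (pd (Some (j, b)) f) t z * (z (N - t) - z' (N - t)) $ Some (j, b)))"
    by (subst sum.cartesian_product) simp
  also have "\<dots> = Y"
    unfolding Y_def
  proof (intro sum.cong refl)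
    fix j :: 'j and b :: 'd and t assume "t \<in> {..k}"
    then have "N - t + idx j \<le> k + l + n \<longleftrightarrow> \<not> n + t \<le> k + idx j"
      by (auto simp: N_def)
    then show "of_nat (N choose t) * (taylor_coeff (pd (Some (j, b)) f) t z * (z (N - t) - z' (N - t)) $ Some (j, b)) =
      (if n + t \<le> k + idx j then X j b t else 0)"
      by (simp add: zs truncate_seq_def X_def)
  qed
  finally have 1: "taylor_coeff f N z = taylor_coeff f N z' + Y" .
  have S: "S G n k c t s $ a $ b = (\<Sum>j\<in>UNIV. if t \<le> s \<and> idx j + s = n + t
      then of_nat (2 * t choose t) * taylor_coeff (pd (Some (j, b)) f) t z else 0)" if "s \<le> k" for t s b
  proof (cases "t \<le> s")
    case True
    have "int (idx j) = int n - (int s - int t) \<longleftrightarrow> idx j + s = n + t" for j :: 'j by linarith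
    then show ?thesis using True that by (simp add: S_def T_y_eq_taylor_coeff[OF G] f_def z_def cong: if_cong)
  qed (simp add: S_def)
  have "\<Gamma>S G n k l c $ a = (\<Sum>t\<le>k. \<Sum>s\<le>k. \<Sum>b\<in>UNIV. \<gamma> k l t * (S G n k c t s $ a $ b * c (N + n - s) $ b))"
    by (simp add: \<Gamma>S_def matrix_vector_mult_def sum_distrib_left N_def)
  also have "\<dots> = (\<Sum>t\<le>k. \<Sum>s\<le>k. \<Sum>b\<in>UNIV. \<Sum>j\<in>UNIV. if s = n + t - idx j then X j b t else 0)"
  proof (intro sum.cong refl)
    fix t s and b :: 'd assume t: "t \<in> {..k}" and s: "s \<in> {..k}"
    have "\<gamma> k l t * ((if t \<le> s \<and> idx j + s = n + t then of_nat (2 * t choose t) * taylor_coeff (pd (Some (j, b)) f) t z else 0)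
      * c (N + n - s) $ b) = (if s = n + t - idx j then X j b t else 0)" for j
    proof (cases "s = n + t - idx j")
      case True
      then have "t \<le> s" "idx j + s = n + t" "N + n - s = N - t + idx j"
        using idx[of j] t by (auto simp: N_def)
      then show ?thesis using True \<gamma>_mult_central_binomial[of k l t, where 'a='k]
        by (simp add: X_def N_def flip: mult.assoc)
    next
      case False
      then have "\<not> idx j + s = n + t" by linarith
      then show ?thesis using False by simp
    qed
    then show "\<gamma> k l t * (S G n k c t s $ a $ b * c (N + n - s) $ b) = (\<Sum>j\<in>UNIV. if s = n + t - idx j then X j b t else 0)"
      using s by (simp only: S atMost_iff sum_distrib_left sum_distrib_right)
  qed
  also have "\<dots> = (\<Sum>t\<le>k. \<Sum>j\<in>UNIV. \<Sum>b\<in>UNIV. \<Sum>s\<le>k. if s = n + t - idx j then X j b t else 0)"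
    by (rule sum.cong[OF refl], rule sum_reverse3)
  also have "\<dots> = (\<Sum>t\<le>k. \<Sum>j\<in>UNIV. \<Sum>b\<in>UNIV. if n + t \<le> k + idx j then X j b t else 0)"
  proof (intro sum.cong refl)
    fix t and j :: 'j and b :: 'd
    have "n + t - idx j \<le> k \<longleftrightarrow> n + t \<le> k + idx j" by linarith
    then show "(\<Sum>s\<le>k. if s = n + t - idx j then X j b t else 0) = (if n + t \<le> k + idx j then X j b t else 0)"
      by simp
  qed
  also have "\<dots> = Y"
    unfolding Y_def by (subst sum.swap, rule sum.cong[OF refl], rule sum.swap)
  finally have 2: "\<Gamma>S G n k l c $ a = Y" .
  have "T G N (subst_series c) $ a = Y + T G N (subst_series (truncate_seq (k + l + n) c)) $ a"
    using 1 by (simp add: T_eq_taylor_coeff[OF G] f_def z_def z'_def)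
  then show "T G (2 * k + 1 + l) (subst_series c) $ a =
    (\<Gamma>S G n k l c + T G (2 * k + 1 + l) (subst_series (truncate_seq (k + l + n) c))) $ a"
    using 2 by (simp add: N_def)
qed

lemma truncate_seq_cong: "(\<And>i. i \<le> M \<Longrightarrow> c i = c' i) \<Longrightarrow> truncate_seq M c = truncate_seq M c'"
  by (auto simp: truncate_seq_def fun_eq_iff)

text \<open>
  The truncated sequence depends only on \<open>c_0, ..., c_{k+l+n}\<close>, so it is a legitimate remainder.
\<close>

lemma R_bar_eq:
  fixes G :: "'k::{real_normed_field,euclidean_space} \<times> (('k^'d)^('j::{finite,linorder})) \<Rightarrow> 'k^'d"
  assumes G: "C_infinity G" and n: "CARD('j) = n + 1"
  shows "R_bar G n k l c = T G (2 * k + 1 + l) (subst_series (truncate_seq (k + l + n) c))"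
  unfolding R_bar_def
proof (rule the_equality)
  show "\<forall>c'. (\<forall>i\<le>k + l + n. c' i = c i) \<longrightarrow>
    T G (2 * k + 1 + l) (subst_series c') = \<Gamma>S G n k l c' + T G (2 * k + 1 + l) (subst_series (truncate_seq (k + l + n) c))"
  proof (intro allI impI)
    fix c' assume "\<forall>i\<le>k + l + n. c' i = c i"
    then have "truncate_seq (k + l + n) c' = truncate_seq (k + l + n) c" by (intro truncate_seq_cong) simp
    then show "T G (2 * k + 1 + l) (subst_series c') = \<Gamma>S G n k l c' + T G (2 * k + 1 + l) (subst_series (truncate_seq (k + l + n) c))"
      using T_splitting[OF G n, of k l c'] by simp
  qed
next
  fix r
  assume "\<forall>c'. (\<forall>i\<le>k + l + n. c' i = c i) \<longrightarrow> T G (2 * k + 1 + l) (subst_series c') = \<Gamma>S G n k l c' + r"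
  then have "T G (2 * k + 1 + l) (subst_series c) = \<Gamma>S G n k l c + r" by simp
  then show "r = T G (2 * k + 1 + l) (subst_series (truncate_seq (k + l + n) c))"
    using T_splitting[OF G n, of k l c] by simp
qed

lemma T_eq_GammaS_R_bar:
  fixes G :: "'k::{real_normed_field,euclidean_space} \<times> (('k^'d)^('j::{finite,linorder})) \<Rightarrow> 'k^'d"
  assumes G: "C_infinity G" and n: "CARD('j) = n + 1"
  shows "T G (2 * k + 1 + l) (subst_series c) = \<Gamma>S G n k l c + R_bar G n k l c"
  unfolding R_bar_eq[OF G n] by (rule T_splitting[OF G n])

lemma R_bar_cong:
  fixes G :: "'k::{real_normed_field,euclidean_space} \<times> (('k^'d)^('j::{finite,linorder})) \<Rightarrow> 'k^'d"
  assumes "C_infinity G" and "CARD('j) = n + 1" and "\<And>i. i \<le> k + l + n \<Longrightarrow> c i = c' i"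
  shows "R_bar G n k l c = R_bar G n k l c'"
  using truncate_seq_cong[of "k + l + n" c c'] assms(3) by (simp add: R_bar_eq[OF assms(1,2)])

lemma S_cong:
  fixes G :: "'k::{real_normed_field,euclidean_space} \<times> (('k^'d)^('j::{finite,linorder})) \<Rightarrow> 'k^'d"
  assumes "C_infinity G" and n: "CARD('j) = n + 1" and "\<And>i. i \<le> k + n \<Longrightarrow> c i = c' i"
  shows "S G n k c t s = S G n k c' t s"
proof (cases "t \<le> s \<and> s \<le> k")
  case True
  have "coords (subst_series c i) = (coords (subst_series c' i) :: 'k^(('j \<times> 'd) option))" if "i \<le> t" for i
  proof -
    have "i + idx j \<le> k + n" for j :: 'j using that True idx_le[OF n, of j] by linarith
    then show ?thesis by (simp add: subst_series_def assms(3))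
  qed
  then have "taylor_coeff f t (\<lambda>s. coords (subst_series c s)) = taylor_coeff f t (\<lambda>s. coords (subst_series c' s))"
    for f :: "'k^(('j \<times> 'd) option) \<Rightarrow> 'k" by (rule taylor_coeff_cong)
  then show ?thesis using True by (simp add: S_def vec_eq_iff T_y_eq_taylor_coeff[OF assms(1)] cong: if_cong)
qed (auto simp: S_def)

lemma H_eq_S_column:
  "H G n m l c = (\<chi> a b. \<Sum>i\<le>m. \<gamma> m l i * S G n m c i m $ a $ b)"
  by (simp add: H_def S_def diff_diff_eq2 diff_add_eq)

section \<open>Power series solutions as solutions of a linear recursion\<close>

lemma GammaS_eq_0:
  assumes "\<And>t s. t \<le> k \<Longrightarrow> s \<le> k \<Longrightarrow> S G n k c t s = 0"
  shows "\<Gamma>S G n k l c = 0"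
  using assms by (simp add: \<Gamma>S_def matrix_vector_mult_def vec_eq_iff)

lemma GammaS_last_column:
  assumes "\<And>t s. s < m \<Longrightarrow> S G n m c t s = 0"
  shows "\<Gamma>S G n m l c = H G n m l c *v c (m + 1 + l + n)"
proof -
  have "(\<Sum>s\<le>m. S G n m c t s *v c (2 * m + 1 + l + n - s)) = S G n m c t m *v c (m + 1 + l + n)" for t
  proof -
    have "(\<Sum>s\<le>m. S G n m c t s *v c (2 * m + 1 + l + n - s)) = (\<Sum>s\<in>{m}. S G n m c t s *v c (2 * m + 1 + l + n - s))"
      by (rule sum.mono_neutral_right) (auto simp: assms)
    moreover have "2 * m + 1 + l + n - m = m + 1 + l + n" by simp
    ultimately show ?thesis by (simp add: add.assoc)
  qed
  then show ?thesis
    by (simp add: \<Gamma>S_def H_eq_S_column vec_eq_iff matrix_vector_mult_def sum_distrib_left sum_distrib_right mult_ac)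
      (intro allI sum.swap)
qed

text \<open>
  Every order \<open>N\<close> between 1 and \<open>2m\<close> is \<open>2k + 1 + l\<close> with \<open>k < m\<close> and \<open>l \<le> 1\<close>; there the matrix part
  vanishes with \<open>S_{m-1}\<close> and the remainder by assumption. The higher orders are the equations of
  the recursion. In both cases the blocks of \<open>S\<close> depend only on coefficients
  shared by \<open>c\<close> and \<open>c'\<close>.
\<close>

lemma continuations_iff:
  fixes G :: "'k::{real_normed_field,euclidean_space} \<times> (('k^'d)^('j::{finite,linorder})) \<Rightarrow> 'k^'d"
  assumes G: "C_infinity G" and n: "CARD('j) = n + 1" and m: "m \<ge> 1"
    and init: "G (0, \<chi> j. c (idx j)) = 0"
    and S_prev: "S G n (m - 1) c = (\<lambda>i s. 0)"
    and R_odd: "\<forall>k<m. R_bar G n k 0 c = 0"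
    and R_even: "\<forall>k<m. R_bar G n k 1 c = 0"
  shows "c' \<in> continuations G (m + n) c \<longleftrightarrow>
    (\<forall>i\<le>m + n. c' i = c i) \<and> (\<forall>l. H G n m l c *v c' (m + 1 + l + n) + R_bar G n m l c' = 0)"
proof (cases "\<forall>i\<le>m + n. c' i = c i")
  case agree: True
  have S_blocks: "S G n k c' t s = 0" if "s < m" for k t s
  proof -
    have "S G n (m - 1) c' t s = S G n (m - 1) c t s"
      by (rule S_cong[OF G n]) (use agree in simp)
    then have "S G n (m - 1) c' t s = 0" using S_prev by simp
    then show ?thesis using that m by (auto simp: S_def split: if_splits)
  qed
  have low: "T G N (subst_series c') = 0" if N: "N \<le> 2 * m" for N
  proof (cases "N = 0")
    case True
    have "T G 0 (subst_series c') = G (0, \<chi> j. c' (idx j))"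
      by (simp add: T_def subst_series_def kscale_def vec_eq_iff)
    moreover have "idx j \<le> m + n" for j :: 'j using idx_le[OF n, of j] by simp
    ultimately show ?thesis using True agree init by simp
  next
    case False
    define k where "k = (N - 1) div 2"
    define l where "l = (N - 1) mod 2"
    have kl: "N = 2 * k + 1 + l" "l = 0 \<or> l = 1" "k < m"
      using False N by (auto simp: k_def l_def)
    have "R_bar G n k l c' = R_bar G n k l c"
      by (rule R_bar_cong[OF G n]) (use agree kl in auto)
    then have "R_bar G n k l c' = 0" using kl R_odd R_even by auto
    moreover have "\<Gamma>S G n k l c' = 0" by (rule GammaS_eq_0) (use S_blocks kl in auto)
    ultimately show ?thesis using T_eq_GammaS_R_bar[OF G n, of k l c'] kl by simp
  qed
  have "H G n m l c' = H G n m l c" for l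
    using S_cong[OF G n, of m c' c] agree by (simp add: H_eq_S_column)
  then have high: "T G (2 * m + 1 + l) (subst_series c') = H G n m l c *v c' (m + 1 + l + n) + R_bar G n m l c'" for l
    using T_eq_GammaS_R_bar[OF G n, of m l c'] GammaS_last_column[of m G n c' l] S_blocks by simp
  have "power_series_solution G c' \<longleftrightarrow> (\<forall>l. T G (2 * m + 1 + l) (subst_series c') = 0)"
    unfolding power_series_solution_def
  proof (intro iffI allI)
    fix N assume *: "\<forall>l. T G (2 * m + 1 + l) (subst_series c') = 0"
    show "T G N (subst_series c') = 0"
    proof (cases "N \<le> 2 * m")
      case False
      then show ?thesis using *[rule_format, of "N - (2 * m + 1)"] by simp
    qed (rule low)
  qed simp
  then show ?thesis using agree high by (simp add: continuations_def)
next
  case False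
  then show ?thesis unfolding continuations_def by blast
qed
section \<open>Irreducible algebraic sets\<close>

lemma polynomial_fun_diff:
  "polynomial_fun I f \<Longrightarrow> polynomial_fun I h \<Longrightarrow> polynomial_fun I (\<lambda>v. f v - h v)"
  using polynomial_fun.add[of I f "\<lambda>v. (- 1) * h v"] polynomial_fun.mult[OF polynomial_fun.const[of I "- 1"], of h]
  by simp

lemma polynomial_fun_power: "polynomial_fun I f \<Longrightarrow> polynomial_fun I (\<lambda>v. f v ^ k)"
  by (induction k) (auto intro: polynomial_fun.intros)

lemma polynomial_fun_prod:
  "(\<And>i. i \<in> A \<Longrightarrow> polynomial_fun I (f i)) \<Longrightarrow> polynomial_fun I (\<lambda>v. \<Prod>i\<in>A. f i v)"
  by (induction A rule: infinite_finite_induct) (auto intro: polynomial_fun.intros)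

lemma algebraic_set_zeros:
  "(\<And>f. f \<in> P \<Longrightarrow> polynomial_fun I f) \<Longrightarrow> algebraic_set I {v \<in> I \<rightarrow>\<^sub>E UNIV. \<forall>f\<in>P. f v = 0}"
  unfolding algebraic_set_def by blast

lemma algebraic_set_Int_zeros:
  assumes "algebraic_set I V" "polynomial_fun I f"
  shows "algebraic_set I {v \<in> V. f v = 0}"
proof -
  obtain P where "\<forall>h\<in>P. polynomial_fun I h" "V = {v \<in> I \<rightarrow>\<^sub>E UNIV. \<forall>h\<in>P. h v = 0}"
    using assms(1) unfolding algebraic_set_def by blast
  then show ?thesis
    using assms(2) unfolding algebraic_set_def by (intro exI[of _ "insert f P"]) auto
qed

lemma algebraic_set_separate:
  assumes "algebraic_set I V" "v \<in> I \<rightarrow>\<^sub>E UNIV" "v \<notin> V"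
  obtains f where "polynomial_fun I f" "\<forall>u\<in>V. f u = 0" "f v \<noteq> 0"
  using assms unfolding algebraic_set_def by blast

lemma algebraic_set_subset: "algebraic_set I V \<Longrightarrow> V \<subseteq> I \<rightarrow>\<^sub>E UNIV"
  unfolding algebraic_set_def by blast

text \<open>
  The algebraic content of irreducibility: the coordinate ring is an integral domain.
\<close>

lemma irreducible_no_zero_divisors:
  fixes W :: "('i \<Rightarrow> 'k::idom) set"
  assumes W: "irreducible_algebraic_set I W" and f: "polynomial_fun I f" and h: "polynomial_fun I h"
    and zero: "\<forall>v\<in>W. f v * h v = 0"
  shows "(\<forall>v\<in>W. f v = 0) \<or> (\<forall>v\<in>W. h v = 0)"
proof -
  have alg: "algebraic_set I W" using W by (simp add: irreducible_algebraic_set_def)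
  have "W = {v \<in> W. f v = 0} \<union> {v \<in> W. h v = 0}" using zero by auto
  then have "W = {v \<in> W. f v = 0} \<or> W = {v \<in> W. h v = 0}"
    using W algebraic_set_Int_zeros[OF alg f] algebraic_set_Int_zeros[OF alg h]
    unfolding irreducible_algebraic_set_def by blast
  then show ?thesis by blast
qed

lemma algebraic_set_singleton:
  fixes v :: "'i \<Rightarrow> 'k::comm_ring_1"
  assumes "v \<in> I \<rightarrow>\<^sub>E UNIV"
  shows "algebraic_set I {v}"
proof -
  have "u = v" if "u \<in> I \<rightarrow>\<^sub>E UNIV" "\<And>q. q \<in> I \<Longrightarrow> u q = v q" for u
    using that assms by (intro PiE_ext) auto
  then have "{v} = {u \<in> I \<rightarrow>\<^sub>E UNIV. \<forall>f\<in>(\<lambda>q u. u q - v q) ` I. f u = 0}"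
    using assms by auto
  moreover have "polynomial_fun I f" if "f \<in> (\<lambda>q u. u q - v q) ` I" for f
    using that by (auto intro!: polynomial_fun_diff polynomial_fun.coord polynomial_fun.const)
  ultimately show ?thesis using algebraic_set_zeros[of "(\<lambda>q u. u q - v q) ` I" I] by simp
qed

lemma irreducible_singleton:
  fixes v :: "'i \<Rightarrow> 'k::comm_ring_1"
  assumes "v \<in> I \<rightarrow>\<^sub>E UNIV"
  shows "irreducible_algebraic_set I {v}"
  using algebraic_set_singleton[OF assms] by (simp add: irreducible_algebraic_set_def singleton_Un_iff)

definition line :: "'i set \<Rightarrow> ('i \<Rightarrow> 'k::comm_ring_1) \<Rightarrow> ('i \<Rightarrow> 'k) \<Rightarrow> ('i \<Rightarrow> 'k) set" where
  "line I v w = range (\<lambda>t. \<lambda>q\<in>I. v q + t * w q)"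

lemma polynomial_fun_on_line:
  assumes "polynomial_fun I f"
  shows "\<exists>P. \<forall>t. f (\<lambda>q\<in>I. v q + t * w q) = poly P t"
  using assms
proof induction
  case (const a)
  show ?case by (rule exI[of _ "[:a:]"]) simp
next
  case (coord i)
  then show ?case by (simp add: exI[of _ "[:v i, w i:]"])
next
  case (add f h)
  from add.IH(1) obtain P where P: "\<forall>t. f (\<lambda>q\<in>I. v q + t * w q) = poly P t" ..
  from add.IH(2) obtain Q where Q: "\<forall>t. h (\<lambda>q\<in>I. v q + t * w q) = poly Q t" ..
  show ?case by (rule exI[of _ "P + Q"]) (simp only: P poly_add Q simp_thms)
next
  case (mult f h)
  from mult.IH(1) obtain P where P: "\<forall>t. f (\<lambda>q\<in>I. v q + t * w q) = poly P t" ..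
  from mult.IH(2) obtain Q where Q: "\<forall>t. h (\<lambda>q\<in>I. v q + t * w q) = poly Q t" ..
  show ?case by (rule exI[of _ "P * Q"]) (simp only: P poly_mult Q simp_thms)
qed

lemma algebraic_set_line:
  fixes v w :: "'i \<Rightarrow> 'k::field"
  assumes "p \<in> I" "w p \<noteq> 0"
  shows "algebraic_set I (line I v w)"
proof -
  define E where "E = (\<lambda>q u. (u q - v q) * w p - w q * (u p - v p)) ` I"
  have "line I v w = {u \<in> I \<rightarrow>\<^sub>E UNIV. \<forall>f\<in>E. f u = 0}"
  proof (intro subset_antisym subsetI)
    fix u assume "u \<in> line I v w"
    then show "u \<in> {u \<in> I \<rightarrow>\<^sub>E UNIV. \<forall>f\<in>E. f u = 0}"
      using assms by (auto simp: line_def E_def)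
  next
    fix u assume u: "u \<in> {u \<in> I \<rightarrow>\<^sub>E UNIV. \<forall>f\<in>E. f u = 0}"
    define t where "t = (u p - v p) / w p"
    have "u q = v q + t * w q" if "q \<in> I" for q
    proof -
      have "(u q - v q) * w p = w q * (u p - v p)" using u that by (simp add: E_def)
      then show ?thesis using assms(2) by (simp add: t_def field_simps)
    qed
    then have "u = (\<lambda>q\<in>I. v q + t * w q)" using u by (intro PiE_ext[of u I "\<lambda>_. UNIV"]) auto
    then show "u \<in> line I v w" by (auto simp: line_def)
  qed
  moreover have "polynomial_fun I f" if "f \<in> E" for f
    using that assms(1) unfolding E_def
    by (auto intro!: polynomial_fun_diff polynomial_fun.mult polynomial_fun.coord polynomial_fun.const)
  ultimately show ?thesis using algebraic_set_zeros[of E I] by simp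
qed

text \<open>
  Polynomials restricted to a line become polynomials in one variable over an infinite field,
  and these have no zero divisors as functions.
\<close>

lemma irreducible_line:
  fixes v w :: "'i \<Rightarrow> 'k::field_char_0"
  assumes "p \<in> I" "w p \<noteq> 0"
  shows "irreducible_algebraic_set I (line I v w)"
  unfolding irreducible_algebraic_set_def
proof (intro conjI allI impI)
  show "algebraic_set I (line I v w)" by (rule algebraic_set_line[of p I w v, OF assms])
  show "line I v w \<noteq> {}" by (simp add: line_def)
  fix A B assume A: "algebraic_set I A" and B: "algebraic_set I B" and un: "line I v w = A \<union> B"
  have sub: "line I v w \<subseteq> I \<rightarrow>\<^sub>E UNIV" by (auto simp: line_def)
  show "line I v w = A \<or> line I v w = B"
  proof (rule ccontr)
    assume neg: "\<not> (line I v w = A \<or> line I v w = B)"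
    obtain x where x: "x \<in> line I v w" "x \<notin> A" using un neg by blast
    obtain y where y: "y \<in> line I v w" "y \<notin> B" using un neg by blast
    obtain f where f: "polynomial_fun I f" "\<forall>u\<in>A. f u = 0" "f x \<noteq> 0"
      using algebraic_set_separate[OF A _ x(2)] x(1) sub by blast
    obtain h where h: "polynomial_fun I h" "\<forall>u\<in>B. h u = 0" "h y \<noteq> 0"
      using algebraic_set_separate[OF B _ y(2)] y(1) sub by blast
    obtain P where P: "\<And>t. f (\<lambda>q\<in>I. v q + t * w q) = poly P t"
      using polynomial_fun_on_line[OF f(1)] by blast
    obtain Q where Q: "\<And>t. h (\<lambda>q\<in>I. v q + t * w q) = poly Q t"
      using polynomial_fun_on_line[OF h(1)] by blast
    have "poly (P * Q) t = 0" for t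
    proof -
      have "(\<lambda>q\<in>I. v q + t * w q) \<in> A \<union> B" unfolding un[symmetric] line_def by blast
      then show ?thesis using f(2) h(2) by (auto simp flip: P Q)
    qed
    then have "P * Q = 0" by (simp add: poly_all_0_iff_0[symmetric])
    moreover have "P \<noteq> 0" using x(1) f(3) P by (auto simp: line_def)
    moreover have "Q \<noteq> 0" using y(1) h(3) Q by (auto simp: line_def)
    ultimately show False by simp
  qed
qed

section \<open>The dimension of affine space bounds chains of irreducible sets\<close>

text \<open>
  Polynomial functions of degree at most \<open>e\<close> in each variable separately, so that the number of
  monomials is simply \<open>(e + 1) ^ card I\<close>.
\<close>

definition polys :: "'i set \<Rightarrow> nat \<Rightarrow> (('i \<Rightarrow> 'k::comm_ring_1) \<Rightarrow> 'k) set" where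
  "polys I e = {f. \<exists>M. f = (\<lambda>v. \<Sum>\<beta>\<in>I \<rightarrow>\<^sub>E {..e}. M \<beta> * (\<Prod>i\<in>I. v i ^ \<beta> i))}"

lemma polys_monomial:
  assumes "finite I" "\<beta> \<in> I \<rightarrow>\<^sub>E {..e}"
  shows "(\<lambda>v. \<Prod>i\<in>I. v i ^ \<beta> i) \<in> polys I e"
  unfolding polys_def
  by (rule CollectI, rule exI[of _ "\<lambda>\<beta>'. if \<beta>' = \<beta> then 1 else 0"])
    (use assms in \<open>simp add: finite_PiE mult_delta_left\<close>)

lemma polysE:
  assumes "f \<in> polys I e"
  obtains M where "f = (\<lambda>v. \<Sum>\<beta>\<in>I \<rightarrow>\<^sub>E {..e}. M \<beta> * (\<Prod>i\<in>I. v i ^ \<beta> i))"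
  using assms unfolding polys_def mem_Collect_eq by (rule exE)

lemma polysI: "(\<lambda>v. \<Sum>\<beta>\<in>I \<rightarrow>\<^sub>E {..e}. M \<beta> * (\<Prod>i\<in>I. v i ^ \<beta> i)) \<in> polys I e"
  unfolding polys_def mem_Collect_eq by (rule exI, rule refl)

lemma polys_add:
  assumes "f \<in> polys I e" "h \<in> polys I e"
  shows "(\<lambda>v. f v + h v) \<in> polys I e"
proof -
  obtain M where M: "f = (\<lambda>v. \<Sum>\<beta>\<in>I \<rightarrow>\<^sub>E {..e}. M \<beta> * (\<Prod>i\<in>I. v i ^ \<beta> i))"
    by (rule polysE[OF assms(1)])
  obtain M' where M': "h = (\<lambda>v. \<Sum>\<beta>\<in>I \<rightarrow>\<^sub>E {..e}. M' \<beta> * (\<Prod>i\<in>I. v i ^ \<beta> i))"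
    by (rule polysE[OF assms(2)])
  show ?thesis
    using polysI[where I=I and e=e and M="\<lambda>\<beta>. M \<beta> + M' \<beta>"] by (simp add: M M' distrib_right sum.distrib)
qed

lemma polys_scale:
  assumes "f \<in> polys I e"
  shows "(\<lambda>v. a * f v) \<in> polys I e"
proof -
  obtain M where M: "f = (\<lambda>v. \<Sum>\<beta>\<in>I \<rightarrow>\<^sub>E {..e}. M \<beta> * (\<Prod>i\<in>I. v i ^ \<beta> i))"
    by (rule polysE[OF assms])
  show ?thesis
    using polysI[where I=I and e=e and M="\<lambda>\<beta>. a * M \<beta>"] by (simp add: M sum_distrib_left mult.assoc)
qed

lemma polys_0: "(\<lambda>v. 0) \<in> polys I e"
  unfolding polys_def by (rule CollectI, rule exI[of _ "\<lambda>_. 0"]) simp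

lemma polys_sum: "(\<And>x. x \<in> A \<Longrightarrow> f x \<in> polys I e) \<Longrightarrow> (\<lambda>v. \<Sum>x\<in>A. f x v) \<in> polys I e"
  by (induction A rule: infinite_finite_induct) (simp_all add: polys_add polys_0)

text \<open>
  By linearity in the first factor a product may be examined monomial by monomial.
\<close>

lemma polys_mult_monomialwise:
  assumes "f \<in> polys I e" and "\<And>\<beta>. \<beta> \<in> I \<rightarrow>\<^sub>E {..e} \<Longrightarrow> (\<lambda>v. (\<Prod>i\<in>I. v i ^ \<beta> i) * h v) \<in> polys I e'"
  shows "(\<lambda>v. f v * h v) \<in> polys I e'"
proof -
  obtain M where f: "f = (\<lambda>v. \<Sum>\<beta>\<in>I \<rightarrow>\<^sub>E {..e}. M \<beta> * (\<Prod>i\<in>I. v i ^ \<beta> i))"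
    by (rule polysE[OF assms(1)])
  have "(\<lambda>v. \<Sum>\<beta>\<in>I \<rightarrow>\<^sub>E {..e}. M \<beta> * ((\<Prod>i\<in>I. v i ^ \<beta> i) * h v)) \<in> polys I e'"
    by (intro polys_sum polys_scale assms(2))
  then show ?thesis by (simp add: f sum_distrib_right mult.assoc)
qed

lemma polys_mult:
  assumes I: "finite I" and f: "f \<in> polys I e" and h: "h \<in> polys I e'"
  shows "(\<lambda>v. f v * h v) \<in> polys I (e + e')"
proof (rule polys_mult_monomialwise[OF f])
  fix \<beta> assume \<beta>: "\<beta> \<in> I \<rightarrow>\<^sub>E {..e}"
  have "(\<lambda>v. h v * (\<Prod>i\<in>I. v i ^ \<beta> i)) \<in> polys I (e + e')"
  proof (rule polys_mult_monomialwise[OF h])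
    fix \<beta>' assume \<beta>': "\<beta>' \<in> I \<rightarrow>\<^sub>E {..e'}"
    have "(\<lambda>i\<in>I. \<beta> i + \<beta>' i) \<in> I \<rightarrow>\<^sub>E {..e + e'}"
      using PiE_mem[OF \<beta>] PiE_mem[OF \<beta>'] by (auto intro!: add_mono)
    from polys_monomial[OF I this]
    show "(\<lambda>v. (\<Prod>i\<in>I. v i ^ \<beta>' i) * (\<Prod>i\<in>I. v i ^ \<beta> i)) \<in> polys I (e + e')"
      by (simp add: power_add prod.distrib mult.commute cong: prod.cong)
  qed
  then show "(\<lambda>v. (\<Prod>i\<in>I. v i ^ \<beta> i) * h v) \<in> polys I (e + e')" by (simp add: mult.commute)
qed

lemma polys_1: "finite I \<Longrightarrow> (\<lambda>v. 1) \<in> polys I e"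
  using polys_monomial[of I "\<lambda>i\<in>I. 0" e] by (simp cong: prod.cong)

lemma polys_mono:
  assumes "finite I" "f \<in> polys I e" "e \<le> e'"
  shows "f \<in> polys I e'"
  using polys_mult[OF assms(1,2) polys_1[OF assms(1), of "e' - e"]] assms(3) by simp

lemma polys_power: "finite I \<Longrightarrow> f \<in> polys I e \<Longrightarrow> (\<lambda>v. f v ^ k) \<in> polys I (k * e)"
proof (induction k)
  case (Suc k)
  then show ?case using polys_mult[of I f e "\<lambda>v. f v ^ k" "k * e"] by simp
qed (simp add: polys_1)

lemma polys_prod:
  assumes "finite I" "\<And>x. x \<in> A \<Longrightarrow> f x \<in> polys I e"
  shows "(\<lambda>v. \<Prod>x\<in>A. f x v) \<in> polys I (card A * e)"
  using assms(2)
proof (induction A rule: infinite_finite_induct)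
  case (insert x A)
  then show ?case using polys_mult[OF assms(1), of "f x" e "\<lambda>v. \<Prod>x\<in>A. f x v" "card A * e"] by simp
qed (simp_all add: polys_1 assms(1))

lemma polynomial_fun_imp_polys:
  fixes f :: "('i \<Rightarrow> 'k::comm_ring_1) \<Rightarrow> 'k"
  assumes "finite I" "polynomial_fun I f"
  shows "\<exists>e. f \<in> polys I e"
  using assms(2)
proof induction
  case (const a)
  show ?case using polys_scale[OF polys_1[OF assms(1)], of a] by auto
next
  case (coord i)
  define \<beta> :: "'i \<Rightarrow> nat" where "\<beta> = (\<lambda>j\<in>I. if j = i then 1 else 0)"
  have "\<beta> \<in> I \<rightarrow>\<^sub>E {..1}" by (auto simp: \<beta>_def)
  from polys_monomial[OF assms(1) this]
  have "(\<lambda>v :: 'i \<Rightarrow> 'k. \<Prod>j\<in>I. v j ^ \<beta> j) \<in> polys I 1" .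
  moreover have "(\<lambda>v :: 'i \<Rightarrow> 'k. \<Prod>j\<in>I. v j ^ \<beta> j) = (\<lambda>v. v i)"
  proof
    fix v :: "'i \<Rightarrow> 'k"
    have "(\<Prod>j\<in>I. v j ^ \<beta> j) = (\<Prod>j\<in>I. if j = i then v j else 1)"
      by (rule prod.cong) (auto simp: \<beta>_def)
    also have "\<dots> = v i" using coord assms(1) by simp
    finally show "(\<Prod>j\<in>I. v j ^ \<beta> j) = v i" .
  qed
  ultimately have "(\<lambda>v :: 'i \<Rightarrow> 'k. v i) \<in> polys I 1" by (simp only:)
  then show ?case ..
next
  case (add f h)
  then obtain e e' where "f \<in> polys I e" "h \<in> polys I e'" by blast
  then show ?case
    using polys_add[OF polys_mono[OF assms(1), of f e "e + e'"] polys_mono[OF assms(1), of h e' "e + e'"]] by auto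
next
  case (mult f h)
  then show ?case using polys_mult[OF assms(1)] by blast
qed

text \<open>
  Gaussian elimination: one equation is used to eliminate one unknown.
\<close>

lemma underdetermined_system_nontrivial_solution:
  fixes M :: "'a \<Rightarrow> 'b \<Rightarrow> 'k::field"
  assumes "finite B" "finite A" "card B < card A"
  shows "\<exists>x. (\<exists>\<alpha>\<in>A. x \<alpha> \<noteq> 0) \<and> (\<forall>\<beta>\<in>B. (\<Sum>\<alpha>\<in>A. x \<alpha> * M \<alpha> \<beta>) = 0)"
  using assms
proof (induction B arbitrary: A M rule: finite_induct)
  case empty
  then have "A \<noteq> {}" by auto
  then show ?case by (intro exI[of _ "\<lambda>_. 1"]) auto
next
  case (insert \<beta>0 B)
  show ?case
  proof (cases "\<forall>\<alpha>\<in>A. M \<alpha> \<beta>0 = 0")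
    case True
    have "card B < card A" using insert by simp
    from insert.IH[OF insert.prems(1) this, of M] obtain x where
      "\<exists>\<alpha>\<in>A. x \<alpha> \<noteq> 0" "\<forall>\<beta>\<in>B. (\<Sum>\<alpha>\<in>A. x \<alpha> * M \<alpha> \<beta>) = 0" by blast
    then show ?thesis using True by (intro exI[of _ x]) simp
  next
    case False
    then obtain \<alpha>0 where \<alpha>0: "\<alpha>0 \<in> A" "M \<alpha>0 \<beta>0 \<noteq> 0" by blast
    define A' where "A' = A - {\<alpha>0}"
    have A': "finite A'" "card B < card A'" "A = insert \<alpha>0 A'" "\<alpha>0 \<notin> A'"
      using insert \<alpha>0 by (auto simp: A'_def)
    from insert.IH[OF A'(1,2), of "\<lambda>\<alpha> \<beta>. M \<alpha> \<beta> - M \<alpha> \<beta>0 / M \<alpha>0 \<beta>0 * M \<alpha>0 \<beta>"] obtain x where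
      x: "\<exists>\<alpha>\<in>A'. x \<alpha> \<noteq> 0"
        "\<forall>\<beta>\<in>B. (\<Sum>\<alpha>\<in>A'. x \<alpha> * (M \<alpha> \<beta> - M \<alpha> \<beta>0 / M \<alpha>0 \<beta>0 * M \<alpha>0 \<beta>)) = 0" by blast
    define s where "s = (\<Sum>\<alpha>\<in>A'. x \<alpha> * M \<alpha> \<beta>0) / M \<alpha>0 \<beta>0"
    define y where "y = x(\<alpha>0 := - s)"
    have sum_y: "(\<Sum>\<alpha>\<in>A. y \<alpha> * M \<alpha> \<beta>) = (\<Sum>\<alpha>\<in>A'. x \<alpha> * M \<alpha> \<beta>) - s * M \<alpha>0 \<beta>" for \<beta>
    proof -
      have "(\<Sum>\<alpha>\<in>A'. y \<alpha> * M \<alpha> \<beta>) = (\<Sum>\<alpha>\<in>A'. x \<alpha> * M \<alpha> \<beta>)"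
        using A'(4) by (intro sum.cong) (auto simp: y_def)
      then show ?thesis using A' by (simp add: y_def)
    qed
    have "(\<Sum>\<alpha>\<in>A. y \<alpha> * M \<alpha> \<beta>0) = 0" using \<alpha>0(2) by (simp add: sum_y s_def)
    moreover have "(\<Sum>\<alpha>\<in>A. y \<alpha> * M \<alpha> \<beta>) = 0" if "\<beta> \<in> B" for \<beta>
    proof -
      have "0 = (\<Sum>\<alpha>\<in>A'. x \<alpha> * M \<alpha> \<beta> - x \<alpha> * M \<alpha> \<beta>0 / M \<alpha>0 \<beta>0 * M \<alpha>0 \<beta>)"
        using x(2) that by (simp add: right_diff_distrib mult.assoc)
      also have "\<dots> = (\<Sum>\<alpha>\<in>A'. x \<alpha> * M \<alpha> \<beta>) - s * M \<alpha>0 \<beta>"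
        by (simp add: sum_subtractf s_def sum_divide_distrib sum_distrib_right)
      finally show ?thesis by (simp add: sum_y)
    qed
    moreover have "\<exists>\<alpha>\<in>A. y \<alpha> \<noteq> 0" using x(1) A' by (auto simp: y_def)
    ultimately show ?thesis by blast
  qed
qed

text \<open>
  On \<open>U\<close>, where \<open>f\<close> vanishes, only the term \<open>t = 0\<close> remains, so \<open>P 0\<close> vanishes on \<open>U\<close>. By the second
  assumption on \<open>P\<close> it then vanishes on \<open>W\<close> as well; the remaining sum is divisible by \<open>f\<close>, which can
  be cancelled on the irreducible set \<open>W\<close>.
\<close>

lemma vanishing_power_sum:
  fixes W :: "('i \<Rightarrow> 'k::idom) set"
  assumes W: "irreducible_algebraic_set I W" and "U \<subseteq> W"
    and f: "polynomial_fun I f" "\<forall>v\<in>U. f v = 0" "\<not> (\<forall>v\<in>W. f v = 0)"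
    and P: "\<And>t. polynomial_fun I (P t)" "\<And>t. t \<le> D \<Longrightarrow> \<forall>v\<in>U. P t v = 0 \<Longrightarrow> \<forall>v\<in>W. P t v = 0"
    and zero: "\<forall>v\<in>W. (\<Sum>t\<le>D. f v ^ t * P t v) = 0"
  shows "\<forall>t\<le>D. \<forall>v\<in>U. P t v = 0"
  using P zero
proof (induction D arbitrary: P)
  case 0
  then show ?case using \<open>U \<subseteq> W\<close> by auto
next
  case (Suc D)
  have split: "(\<Sum>t\<le>Suc D. f v ^ t * P t v) = P 0 v + f v * (\<Sum>t\<le>D. f v ^ t * P (Suc t) v)" for v
    by (subst sum.atMost_Suc_shift) (simp add: sum_distrib_left mult.assoc)
  have U0: "\<forall>v\<in>U. P 0 v = 0"
  proof
    fix v assume "v \<in> U"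
    then have "v \<in> W" "f v = 0" using f(2) \<open>U \<subseteq> W\<close> by auto
    then show "P 0 v = 0" using bspec[OF Suc.prems(3) \<open>v \<in> W\<close>] unfolding split by simp
  qed
  then have "\<forall>v\<in>W. P 0 v = 0" using Suc.prems(2)[of 0] by simp
  have poly: "polynomial_fun I (\<lambda>v. \<Sum>t\<le>D. f v ^ t * P (Suc t) v)"
    by (intro polynomial_fun_sum polynomial_fun.mult polynomial_fun_power f(1) Suc.prems(1))
  have "\<forall>v\<in>W. f v * (\<Sum>t\<le>D. f v ^ t * P (Suc t) v) = 0"
  proof
    fix v assume v: "v \<in> W"
    show "f v * (\<Sum>t\<le>D. f v ^ t * P (Suc t) v) = 0"
      using bspec[OF Suc.prems(3) v] bspec[OF \<open>\<forall>v\<in>W. P 0 v = 0\<close> v] unfolding split by (simp only: add_0_left)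
  qed
  from irreducible_no_zero_divisors[OF W f(1) poly this] f(3)
  have "\<forall>v\<in>W. (\<Sum>t\<le>D. f v ^ t * P (Suc t) v) = 0" by simp
  have shifted: "\<forall>t\<le>D. \<forall>v\<in>U. P (Suc t) v = 0"
  proof (rule Suc.IH[of "\<lambda>t. P (Suc t)"])
    show "polynomial_fun I (P (Suc t))" for t by (rule Suc.prems(1))
    show "\<forall>v\<in>W. P (Suc t) v = 0" if "t \<le> D" "\<forall>v\<in>U. P (Suc t) v = 0" for t
      by (rule Suc.prems(2)) (use that in simp_all)
  qed fact
  show ?case
  proof (intro allI impI)
    fix t assume "t \<le> Suc D"
    then show "\<forall>v\<in>U. P t v = 0"
      using U0 shifted by (cases t) simp_all
  qed
qed

lemma sum_PiE_lessThan_Suc: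
  fixes F :: "(nat \<Rightarrow> nat) \<Rightarrow> 'a::comm_monoid_add"
  shows "(\<Sum>\<alpha>\<in>{..<Suc r} \<rightarrow>\<^sub>E {..D}. F \<alpha>) = (\<Sum>t\<le>D. \<Sum>\<alpha>\<in>{..<r} \<rightarrow>\<^sub>E {..D}. F (\<alpha>(r := t)))"
proof -
  have "inj_on (\<lambda>(t, \<alpha>). \<alpha>(r := t)) ({..D} \<times> ({..<r} \<rightarrow>\<^sub>E {..D}))"
    by (rule inj_combinator) simp
  then show ?thesis
    by (simp add: lessThan_Suc PiE_insert_eq sum.reindex sum.cartesian_product case_prod_unfold)
qed

text \<open>
  Algebraic independence of \<open>f 0, ..., f (r - 1)\<close> on \<open>W r\<close>. A relation on \<open>W (Suc r)\<close> is
  sorted by powers of \<open>f r\<close>; its coefficients are relations between the earlier functions, and by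
  \<open>vanishing_power_sum\<close> each of them holds on \<open>W r\<close>, so it is trivial by induction.
\<close>

lemma chain_monomials_independent:
  fixes W :: "nat \<Rightarrow> ('i \<Rightarrow> 'k::idom) set"
  assumes "\<And>k. k \<le> r \<Longrightarrow> irreducible_algebraic_set I (W k)"
    and "\<And>k. k < r \<Longrightarrow> W k \<subseteq> W (Suc k)"
    and "\<And>k. k < r \<Longrightarrow> polynomial_fun I (f k) \<and> (\<forall>v\<in>W k. f k v = 0) \<and> \<not> (\<forall>v\<in>W (Suc k). f k v = 0)"
    and "\<forall>v\<in>W r. (\<Sum>\<alpha>\<in>{..<r} \<rightarrow>\<^sub>E {..D}. a \<alpha> * (\<Prod>i<r. f i v ^ \<alpha> i)) = 0"
    and "\<alpha> \<in> {..<r} \<rightarrow>\<^sub>E {..D}"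
  shows "a \<alpha> = 0"
  using assms
proof (induction r arbitrary: a \<alpha>)
  case 0
  have "W 0 \<noteq> {}" using 0(1) by (simp add: irreducible_algebraic_set_def)
  then show ?case using 0 by auto
next
  case (Suc r)
  define P where "P = (\<lambda>t v. \<Sum>\<alpha>\<in>{..<r} \<rightarrow>\<^sub>E {..D}. a (\<alpha>(r := t)) * (\<Prod>i<r. f i v ^ \<alpha> i))"
  have IH: "a (\<alpha>(r := t)) = 0" if "\<forall>v\<in>W r. P t v = 0" "\<alpha> \<in> {..<r} \<rightarrow>\<^sub>E {..D}" for t \<alpha>
    by (rule Suc.IH[of "\<lambda>\<alpha>. a (\<alpha>(r := t))"]) (use Suc.prems that in \<open>auto simp: P_def\<close>)
  have "\<forall>t\<le>D. \<forall>v\<in>W r. P t v = 0"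
  proof (rule vanishing_power_sum)
    show "irreducible_algebraic_set I (W (Suc r))" "W r \<subseteq> W (Suc r)" "polynomial_fun I (f r)"
      "\<forall>v\<in>W r. f r v = 0" "\<not> (\<forall>v\<in>W (Suc r). f r v = 0)" using Suc.prems by auto
    show "polynomial_fun I (P t)" for t unfolding P_def
      using Suc.prems(3) by (intro polynomial_fun_sum polynomial_fun.mult polynomial_fun.const polynomial_fun_prod polynomial_fun_power) auto
    show "\<forall>v\<in>W (Suc r). P t v = 0" if "\<forall>v\<in>W r. P t v = 0" for t
      using IH[OF that] by (simp add: P_def)
    show "\<forall>v\<in>W (Suc r). (\<Sum>t\<le>D. f r v ^ t * P t v) = 0"
    proof
      fix v assume "v \<in> W (Suc r)"
      have "(\<Sum>\<alpha>\<in>{..<Suc r} \<rightarrow>\<^sub>E {..D}. a \<alpha> * (\<Prod>i<Suc r. f i v ^ \<alpha> i)) = (\<Sum>t\<le>D. f r v ^ t * P t v)"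
        unfolding sum_PiE_lessThan_Suc P_def sum_distrib_left
        by (intro sum.cong refl) (simp add: mult_ac)
      then show "(\<Sum>t\<le>D. f r v ^ t * P t v) = 0" using Suc.prems(4) \<open>v \<in> W (Suc r)\<close> by simp
    qed
  qed
  moreover obtain t \<alpha>' where "t \<le> D" "\<alpha>' \<in> {..<r} \<rightarrow>\<^sub>E {..D}" "\<alpha> = \<alpha>'(r := t)"
    using Suc.prems(5) by (auto simp: lessThan_Suc PiE_insert_eq)
  ultimately show ?case using IH by blast
qed

text \<open>
  Choose for each proper inclusion a polynomial \<open>f k\<close> that vanishes on the smaller set only. The
  \<open>(D + 1) ^ r\<close> monomials in the \<open>f k\<close> of degree at most \<open>D\<close> in each of them are independent, but they
  lie in a space spanned by \<open>(r D e + 1) ^ card I\<close> monomials in the coordinates. For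
  \<open>r > card I\<close> and large \<open>D\<close> this is impossible.
\<close>

lemma irreducible_chain_length:
  fixes W :: "nat \<Rightarrow> ('i \<Rightarrow> 'k::field) set"
  assumes I: "finite I" and irr: "\<And>k. k \<le> r \<Longrightarrow> irreducible_algebraic_set I (W k)"
    and sub: "\<And>k. k < r \<Longrightarrow> W k \<subset> W (Suc k)"
  shows "r \<le> card I"
proof (rule ccontr)
  assume "\<not> r \<le> card I"
  then have r: "card I < r" by simp
  have "\<forall>k\<in>{..<r}. \<exists>f. polynomial_fun I f \<and> (\<forall>v\<in>W k. f v = 0) \<and> \<not> (\<forall>v\<in>W (Suc k). f v = 0)"
  proof
    fix k assume "k \<in> {..<r}"
    then have that: "k < r" by simp
    have "W k \<subset> W (Suc k)" by (rule sub[OF that])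
    then obtain x where x: "x \<in> W (Suc k)" "x \<notin> W k" by blast
    have alg: "algebraic_set I (W k)" "algebraic_set I (W (Suc k))"
      using irr that by (auto simp: irreducible_algebraic_set_def)
    have xI: "x \<in> I \<rightarrow>\<^sub>E UNIV" using algebraic_set_subset[OF alg(2)] x(1) ..
    obtain f where f: "polynomial_fun I f" "\<forall>u\<in>W k. f u = 0" "f x \<noteq> 0"
      by (rule algebraic_set_separate[OF alg(1) xI x(2)])
    have "\<not> (\<forall>v\<in>W (Suc k). f v = 0)" using x(1) f(3) by blast
    with f(1,2) show "\<exists>f. polynomial_fun I f \<and> (\<forall>v\<in>W k. f v = 0) \<and> \<not> (\<forall>v\<in>W (Suc k). f v = 0)"
      by (intro exI[of _ f] conjI)
  qed
  from bchoice[OF this] obtain f where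
    f: "\<forall>k\<in>{..<r}. polynomial_fun I (f k) \<and> (\<forall>v\<in>W k. f k v = 0) \<and> \<not> (\<forall>v\<in>W (Suc k). f k v = 0)" ..
  have "\<forall>k\<in>{..<r}. \<exists>e. f k \<in> polys I e"
    by (intro ballI polynomial_fun_imp_polys[OF I]) (use f in simp)
  from bchoice[OF this] obtain d where d: "\<forall>k\<in>{..<r}. f k \<in> polys I (d k)" ..
  define e where "e = Suc (\<Sum>k<r. d k)"
  have e: "f k \<in> polys I e" if "k < r" for k
  proof (rule polys_mono[OF I bspec[OF d]])
    show "k \<in> {..<r}" using that by simp
    have "d k \<le> (\<Sum>k<r. d k)" using that by (intro member_le_sum) auto
    then show "d k \<le> e" by (simp add: e_def)
  qed
  \<comment> \<open>Large enough for \<open>(r e (D + 1)) ^ card I < (D + 1) ^ (card I + 1)\<close>.\<close>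
  define D where "D = (r * e) ^ card I"
  define A where "A = {..<r} \<rightarrow>\<^sub>E {..D}"
  define B where "B = I \<rightarrow>\<^sub>E {..r * (D * e)}"
  have fin: "finite A" "finite B" using I by (auto simp: A_def B_def intro: finite_PiE)
  have "(\<lambda>v. \<Prod>i<r. f i v ^ \<alpha> i) \<in> polys I (r * (D * e))" if "\<alpha> \<in> A" for \<alpha>
  proof -
    have "(\<lambda>v. f i v ^ \<alpha> i) \<in> polys I (D * e)" if "i < r" for i
    proof (rule polys_mono[OF I polys_power[OF I e[OF that]]])
      have "\<alpha> i \<le> D" using \<open>\<alpha> \<in> A\<close> that by (auto simp: A_def PiE_iff)
      then show "\<alpha> i * e \<le> D * e" by simp
    qed
    then show ?thesis using polys_prod[OF I, of "{..<r}" "\<lambda>i v. f i v ^ \<alpha> i" "D * e"] by simp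
  qed
  then have "\<forall>\<alpha>\<in>A. \<exists>M. (\<lambda>v. \<Prod>i<r. f i v ^ \<alpha> i) = (\<lambda>v. \<Sum>\<beta>\<in>B. M \<beta> * (\<Prod>i\<in>I. v i ^ \<beta> i))"
    unfolding polys_def B_def by simp
  from bchoice[OF this] obtain M where
    M: "\<forall>\<alpha>\<in>A. (\<lambda>v. \<Prod>i<r. f i v ^ \<alpha> i) = (\<lambda>v. \<Sum>\<beta>\<in>B. M \<alpha> \<beta> * (\<Prod>i\<in>I. v i ^ \<beta> i))" ..
  \<comment> \<open>More unknowns than equations: some combination of the monomials in the \<open>f k\<close> vanishes identically.\<close>
  have "card B < card A"
  proof -
    have re: "r * e \<ge> 1" using r by (simp add: e_def)
    have "card B = Suc (r * e * D) ^ card I" by (simp add: B_def card_PiE I mult_ac)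
    also have "\<dots> \<le> (r * e * Suc D) ^ card I" using re by (intro power_mono) simp_all
    also have "\<dots> = D * Suc D ^ card I" by (simp only: power_mult_distrib D_def)
    also have "\<dots> < Suc D * Suc D ^ card I" by simp
    also have "\<dots> = Suc D ^ Suc (card I)" by simp
    also have "\<dots> \<le> Suc D ^ r" using r by (intro power_increasing) auto
    also have "\<dots> = card A" by (simp add: A_def card_PiE)
    finally show ?thesis .
  qed
  from underdetermined_system_nontrivial_solution[OF fin(2,1) this, of M] obtain a \<alpha> where
    a: "\<alpha> \<in> A" "a \<alpha> \<noteq> 0" "\<forall>\<beta>\<in>B. (\<Sum>\<alpha>\<in>A. a \<alpha> * M \<alpha> \<beta>) = 0" by blast
  have "(\<Sum>\<alpha>\<in>A. a \<alpha> * (\<Prod>i<r. f i v ^ \<alpha> i)) = 0" for v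
  proof -
    have "(\<Sum>\<alpha>\<in>A. a \<alpha> * (\<Prod>i<r. f i v ^ \<alpha> i)) = (\<Sum>\<alpha>\<in>A. \<Sum>\<beta>\<in>B. a \<alpha> * M \<alpha> \<beta> * (\<Prod>i\<in>I. v i ^ \<beta> i))"
    proof (rule sum.cong[OF refl])
      fix \<alpha> assume "\<alpha> \<in> A"
      from fun_cong[OF bspec[OF M this], of v]
      show "a \<alpha> * (\<Prod>i<r. f i v ^ \<alpha> i) = (\<Sum>\<beta>\<in>B. a \<alpha> * M \<alpha> \<beta> * (\<Prod>i\<in>I. v i ^ \<beta> i))"
        by (simp add: sum_distrib_left mult.assoc)
    qed
    also have "\<dots> = (\<Sum>\<beta>\<in>B. (\<Sum>\<alpha>\<in>A. a \<alpha> * M \<alpha> \<beta>) * (\<Prod>i\<in>I. v i ^ \<beta> i))"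
      by (subst sum.swap) (simp add: sum_distrib_right)
    also have "\<dots> = 0" using a(3) by simp
    finally show ?thesis .
  qed
  then have vanish: "\<forall>v\<in>W r. (\<Sum>\<alpha>\<in>{..<r} \<rightarrow>\<^sub>E {..D}. a \<alpha> * (\<Prod>i<r. f i v ^ \<alpha> i)) = 0"
    by (simp add: A_def)
  have "a \<alpha> = 0"
  proof (rule chain_monomials_independent[where W=W and r=r and I=I and f=f and D=D and a=a, OF _ _ _ vanish])
    show "irreducible_algebraic_set I (W k)" if "k \<le> r" for k using that by (rule irr)
    show "W k \<subseteq> W (Suc k)" if "k < r" for k using sub[OF that] by (rule psubset_imp_subset)
    show "polynomial_fun I (f k) \<and> (\<forall>v\<in>W k. f k v = 0) \<and> \<not> (\<forall>v\<in>W (Suc k). f k v = 0)" if "k < r" for k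
      using f that by simp
    show "\<alpha> \<in> {..<r} \<rightarrow>\<^sub>E {..D}" using a(1) by (simp only: A_def)
  qed
  then show False using a(2) by simp
qed

lemma algebraic_dim_bounds:
  fixes V :: "('i \<Rightarrow> 'k::field) set"
  assumes I: "finite I" and "irreducible_algebraic_set I W0" "irreducible_algebraic_set I W1"
    and "W0 \<subset> W1" "W1 \<subseteq> V"
  shows "\<exists>q. algebraic_dim I V = enat q \<and> 1 \<le> q \<and> q \<le> card I"
proof -
  define R where "R = {r. \<exists>W. (\<forall>k\<le>r. irreducible_algebraic_set I (W k) \<and> W k \<subseteq> V) \<and> (\<forall>k<r. W k \<subset> W (Suc k))}"
  have le: "r \<le> card I" if "r \<in> R" for r
    using that irreducible_chain_length[OF I] unfolding R_def by blast
  then have fin: "finite R" by (intro finite_subset[of R "{..card I}"]) auto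
  have "1 \<in> R" unfolding R_def
    by (rule CollectI, rule exI[of _ "\<lambda>k. if k = 0 then W0 else W1"]) (use assms in auto)
  define q where "q = Max R"
  have q: "q \<in> R" "1 \<le> q"
  proof -
    show "q \<in> R" unfolding q_def by (rule Max_in[OF fin]) (use \<open>1 \<in> R\<close> in blast)
    show "1 \<le> q" unfolding q_def by (rule Max_ge[OF fin \<open>1 \<in> R\<close>])
  qed
  have "algebraic_dim I V = (SUP r\<in>R. enat r)" by (simp add: algebraic_dim_def R_def)
  also have "\<dots> = enat q"
  proof (rule antisym)
    show "(SUP r\<in>R. enat r) \<le> enat q" using fin by (intro SUP_least) (simp add: q_def)
    show "enat q \<le> (SUP r\<in>R. enat r)" using q(1) by (rule SUP_upper)
  qed
  finally show ?thesis using q le by blast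
qed
section \<open>Linear recursions with finitely many singular steps\<close>

lemma invertible_solve_iff:
  fixes A :: "'k::field^'d^'d"
  assumes "det A \<noteq> 0"
  shows "A *v x + r = 0 \<longleftrightarrow> x = - (matrix_inv A *v r)"
proof -
  have "\<exists>B. A ** B = mat 1 \<and> B ** A = mat 1"
    using assms unfolding invertible_det_nz[symmetric] invertible_def .
  from someI_ex[OF this] have inv: "A ** matrix_inv A = mat 1" "matrix_inv A ** A = mat 1"
    by (simp_all add: matrix_inv_def)
  have neg: "B *v (- y) = - (B *v y)" for B :: "'k^'d^'d" and y
    by (simp add: matrix_vector_mult_def vec_eq_iff sum_negf)
  show ?thesis
  proof
    assume "A *v x + r = 0"
    then have "A *v x = - r" by (simp add: eq_neg_iff_add_eq_0)
    then have "matrix_inv A *v (A *v x) = - (matrix_inv A *v r)" by (simp add: neg)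
    then show "x = - (matrix_inv A *v r)" by (simp add: matrix_vector_mul_assoc inv)
  next
    assume "x = - (matrix_inv A *v r)"
    then show "A *v x + r = 0" by (simp add: neg matrix_vector_mul_assoc inv)
  qed
qed

text \<open>
  The step \<open>\<Phi>\<close> acts on whole sequences but looks only at the part already constructed. Iterating it on
  \<open>c\<close> produces sequences \<open>s l\<close> which are final up to the index \<open>N + l\<close>; the extension is their
  diagonal.
\<close>

lemma recursive_extension_exists:
  fixes \<Phi> :: "nat \<Rightarrow> (nat \<Rightarrow> 'a) \<Rightarrow> 'a"
  assumes cong: "\<And>l c c'. (\<And>i. i \<le> N + l \<Longrightarrow> c i = c' i) \<Longrightarrow> \<Phi> l c = \<Phi> l c'"
  shows "\<exists>c'. (\<forall>i\<le>N. c' i = c i) \<and> (\<forall>l. c' (N + 1 + l) = \<Phi> l c')"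
proof -
  define s where "s = rec_nat c (\<lambda>l s. s(N + 1 + l := \<Phi> l s))"
  have s: "s 0 = c" "s (Suc l) = (s l)(N + 1 + l := \<Phi> l (s l))" for l by (simp_all add: s_def)
  define c' where "c' = (\<lambda>i. s (i - N) i)"
  have agree: "s l i = c' i" if "i \<le> N + l" for l i
    using that
  proof (induction l)
    case (Suc l)
    show ?case
    proof (cases "i = N + 1 + l")
      case True
      then show ?thesis by (simp add: c'_def)
    next
      case False
      then have "s l i = c' i" using Suc by simp
      then show ?thesis using False by (simp add: s)
    qed
  qed (simp add: c'_def)
  have "c' (N + 1 + l) = \<Phi> l c'" for l
  proof -
    have "c' (N + 1 + l) = \<Phi> l (s l)" by (simp add: c'_def s)
    also have "\<dots> = \<Phi> l c'" by (rule cong) (rule agree)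
    finally show ?thesis .
  qed
  moreover have "c' i = c i" if "i \<le> N" for i using that by (simp add: c'_def s)
  ultimately show ?thesis by blast
qed

lemma recursive_extension_unique:
  fixes \<Phi> :: "nat \<Rightarrow> (nat \<Rightarrow> 'a) \<Rightarrow> 'a"
  assumes cong: "\<And>l c c'. (\<And>i. i \<le> N + l \<Longrightarrow> c i = c' i) \<Longrightarrow> \<Phi> l c = \<Phi> l c'"
    and init: "\<And>i. i \<le> N \<Longrightarrow> c i = c' i"
    and rec: "\<And>l. c (N + 1 + l) = \<Phi> l c" "\<And>l. c' (N + 1 + l) = \<Phi> l c'"
  shows "c = c'"
proof
  fix i
  show "c i = c' i"
  proof (induction i rule: less_induct)
    case (less i)
    show ?case
    proof (cases "i \<le> N")
      case False
      define l where "l = i - (N + 1)"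
      have i: "i = N + 1 + l" using False by (simp add: l_def)
      have "\<Phi> l c = \<Phi> l c'" by (rule cong, rule less) (simp add: i)
      then show ?thesis unfolding i rec .
    qed (rule init)
  qed
qed

text \<open>
  The system seen from its recursion alone: the coefficients up to \<open>N\<close> are given, and
  the coefficient \<open>N + 1 + l\<close> has to satisfy a linear equation whose inhomogeneity depends on the
  earlier ones.
\<close>

locale linear_recursion =
  fixes A :: "nat \<Rightarrow> 'k::field_char_0^'d^'d" and R :: "nat \<Rightarrow> (nat \<Rightarrow> 'k^'d) \<Rightarrow> 'k^'d"
    and N :: nat and c0 :: "nat \<Rightarrow> 'k^'d"
  assumes R_cong: "(\<And>i. i \<le> N + l \<Longrightarrow> c i = c' i) \<Longrightarrow> R l c = R l c'"
begin

definition solutions :: "(nat \<Rightarrow> 'k^'d) set" where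
  "solutions = {c'. (\<forall>i\<le>N. c' i = c0 i) \<and> (\<forall>l. A l *v c' (N + 1 + l) + R l c' = 0)}"

definition next_coeff :: "(nat \<Rightarrow> 'k^'d) \<Rightarrow> nat \<Rightarrow> (nat \<Rightarrow> 'k^'d) \<Rightarrow> 'k^'d" where
  "next_coeff u l c = (if det (A l) = 0 then u l else - (matrix_inv (A l) *v R l c))"

text \<open>
  The sequence obtained from the recursion if the coefficients at the singular steps are chosen to be
  \<open>u\<close>, whether or not they satisfy the equations there.
\<close>

definition fill :: "(nat \<Rightarrow> 'k^'d) \<Rightarrow> nat \<Rightarrow> 'k^'d" where
  "fill u = (SOME c. (\<forall>i\<le>N. c i = c0 i) \<and> (\<forall>l. c (N + 1 + l) = next_coeff u l c))"

lemma next_coeff_cong: "(\<And>i. i \<le> N + l \<Longrightarrow> c i = c' i) \<Longrightarrow> next_coeff u l c = next_coeff u l c'"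
  unfolding next_coeff_def using R_cong[of l c c'] by simp

lemma fill_init: "i \<le> N \<Longrightarrow> fill u i = c0 i"
  and fill_step: "fill u (N + 1 + l) = next_coeff u l (fill u)"
proof -
  from recursive_extension_exists[of N "next_coeff u" c0, OF next_coeff_cong]
  have "\<exists>c. (\<forall>i\<le>N. c i = c0 i) \<and> (\<forall>l. c (N + 1 + l) = next_coeff u l c)" by simp
  from someI_ex[OF this]
  have "(\<forall>i\<le>N. fill u i = c0 i) \<and> (\<forall>l. fill u (N + 1 + l) = next_coeff u l (fill u))"
    unfolding fill_def .
  then show "i \<le> N \<Longrightarrow> fill u i = c0 i" "fill u (N + 1 + l) = next_coeff u l (fill u)" by auto
qed

lemma fill_eqI:
  assumes "\<And>i. i \<le> N \<Longrightarrow> c i = c0 i" "\<And>l. c (N + 1 + l) = next_coeff u l c"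
  shows "fill u = c"
proof (rule recursive_extension_unique[of N "next_coeff u"])
  show "next_coeff u l d = next_coeff u l d'" if "\<And>i. i \<le> N + l \<Longrightarrow> d i = d' i" for l d d'
    by (rule next_coeff_cong) (rule that)
  show "fill u i = c i" if "i \<le> N" for i using assms(1)[OF that] fill_init[OF that] by simp
  show "fill u (N + 1 + l) = next_coeff u l (fill u)" for l by (rule fill_step)
  show "c (N + 1 + l) = next_coeff u l c" for l by (rule assms(2))
qed

lemma solutions_step:
  assumes "c \<in> solutions" "det (A l) \<noteq> 0"
  shows "c (N + 1 + l) = - (matrix_inv (A l) *v R l c)"
proof -
  have "A l *v c (N + 1 + l) + R l c = 0" using assms(1) unfolding solutions_def by blast
  then show ?thesis unfolding invertible_solve_iff[OF assms(2)] .
qed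

lemma solutions_eq_fill:
  assumes "c \<in> solutions" "\<And>l. det (A l) = 0 \<Longrightarrow> u l = c (N + 1 + l)"
  shows "fill u = c"
proof (rule fill_eqI)
  show "c i = c0 i" if "i \<le> N" for i using assms(1) that by (simp add: solutions_def)
  show "c (N + 1 + l) = next_coeff u l c" for l
    unfolding next_coeff_def using assms(2) solutions_step[OF assms(1)] by simp
qed

lemma fill_in_solutions_iff:
  "fill u \<in> solutions \<longleftrightarrow> (\<forall>l. det (A l) = 0 \<longrightarrow> A l *v u l + R l (fill u) = 0)"
proof -
  have "A l *v fill u (N + 1 + l) + R l (fill u) = 0 \<longleftrightarrow> (det (A l) = 0 \<longrightarrow> A l *v u l + R l (fill u) = 0)" for l
  proof (cases "det (A l) = 0")
    case False
    then show ?thesis using invertible_solve_iff[OF False] by (simp only: fill_step next_coeff_def if_False simp_thms)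
  qed (simp only: fill_step next_coeff_def if_True simp_thms)
  then show ?thesis by (simp add: solutions_def fill_init)
qed

theorem unique_solution_if_regular:
  assumes "\<forall>l. det (A l) \<noteq> 0"
  shows "\<exists>!c. c \<in> solutions"
proof -
  have "fill u \<in> solutions" for u using assms by (simp add: fill_in_solutions_iff)
  moreover have "c = fill (\<lambda>_. 0)" if "c \<in> solutions" for c
    by (rule solutions_eq_fill[OF that, symmetric]) (use assms in simp)
  ultimately show ?thesis by (intro ex1I[of _ "fill (\<lambda>_. 0)"])
qed

end

text \<open>
  Polynomial dependence of the inhomogeneity is stated for families \<open>C\<close> of sequences depending on parameters, and only for families with the
  prescribed beginning: in the application \<open>R\<close> depends on the first coefficients through the
  derivatives of \<open>G\<close>, which need not be polynomial.
\<close>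

locale polynomial_recursion = linear_recursion A R N c0
  for A :: "nat \<Rightarrow> 'k::field_char_0^'d^'d" and R N c0 +
  assumes R_polynomial:
    "\<And>(I :: (nat \<times> 'd) set) C l a. (\<And>v i. i \<le> N \<Longrightarrow> C v i = c0 i) \<Longrightarrow>
      (\<And>i a. polynomial_fun I (\<lambda>v. C v i $ a)) \<Longrightarrow> polynomial_fun I (\<lambda>v. R l (C v) $ a)"
  fixes p :: nat and lbar :: "nat \<Rightarrow> nat"
  assumes mono: "strict_mono_on {1..p} lbar"
    and roots: "{l. det (A l) = 0} = lbar ` {1..p}"
begin

definition I :: "(nat \<times> 'd) set" where "I = {1..p} \<times> UNIV"

definition param :: "(nat \<Rightarrow> 'k^'d) \<Rightarrow> nat \<times> 'd \<Rightarrow> 'k" where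
  "param c = (\<lambda>(i, a)\<in>I. c (N + 1 + lbar i) $ a)"

definition choice_of :: "(nat \<times> 'd \<Rightarrow> 'k) \<Rightarrow> nat \<Rightarrow> 'k^'d" where
  "choice_of v l = (\<chi> a. v (inv_into {1..p} lbar l, a))"

lemma choice_of_root: "i \<in> {1..p} \<Longrightarrow> choice_of v (lbar i) = (\<chi> a. v (i, a))"
  using strict_mono_on_imp_inj_on[OF mono] by (simp add: choice_of_def)

lemma root_iff: "det (A l) = 0 \<longleftrightarrow> (\<exists>i\<in>{1..p}. l = lbar i)"
  using roots by blast

lemma det_root: "i \<in> {1..p} \<Longrightarrow> det (A (lbar i)) = 0"
  using root_iff by blast

lemma param_nth: "i \<in> {1..p} \<Longrightarrow> param c (i, a) = c (N + 1 + lbar i) $ a"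
  by (simp add: param_def I_def)

lemma fill_choice_of_root:
  "i \<in> {1..p} \<Longrightarrow> fill (choice_of v) (N + 1 + lbar i) = (\<chi> a. v (i, a))"
  by (simp only: fill_step next_coeff_def det_root choice_of_root simp_thms if_True)

lemma fill_param:
  assumes "c \<in> solutions"
  shows "fill (choice_of (param c)) = c"
proof (rule solutions_eq_fill[OF assms])
  fix l assume "det (A l) = 0"
  then obtain i where "i \<in> {1..p}" "l = lbar i" using root_iff by blast
  then show "choice_of (param c) l = c (N + 1 + l)" by (simp add: choice_of_root param_nth del: atLeastAtMost_iff)
qed

lemma param_fill:
  assumes "v \<in> I \<rightarrow>\<^sub>E UNIV"
  shows "param (fill (choice_of v)) = v"
proof (rule PiE_ext[OF _ assms])
  show "param (fill (choice_of v)) \<in> I \<rightarrow>\<^sub>E UNIV" by (simp add: param_def)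
  fix q assume "q \<in> I"
  then obtain i a where q: "q = (i, a)" "i \<in> {1..p}" by (auto simp: I_def)
  show "param (fill (choice_of v)) q = v q"
    unfolding q(1) param_nth[OF q(2)] fill_choice_of_root[OF q(2)] by simp
qed

lemma inj_on_param: "inj_on param solutions"
  by (rule inj_on_inverseI[of _ "\<lambda>v. fill (choice_of v)"]) (rule fill_param)

definition defect :: "nat \<Rightarrow> 'd \<Rightarrow> (nat \<times> 'd \<Rightarrow> 'k) \<Rightarrow> 'k" where
  "defect i a v = (A (lbar i) *v (\<chi> a. v (i, a)) + R (lbar i) (fill (choice_of v))) $ a"

lemma fill_choice_in_solutions_iff:
  "fill (choice_of v) \<in> solutions \<longleftrightarrow> (\<forall>i\<in>{1..p}. \<forall>a. defect i a v = 0)"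
proof -
  have "fill (choice_of v) \<in> solutions \<longleftrightarrow>
    (\<forall>i\<in>{1..p}. A (lbar i) *v choice_of v (lbar i) + R (lbar i) (fill (choice_of v)) = 0)"
    unfolding fill_in_solutions_iff root_iff by blast
  also have "\<dots> \<longleftrightarrow> (\<forall>i\<in>{1..p}. \<forall>a. defect i a v = 0)"
    by (rule ball_cong[OF refl]) (simp add: choice_of_root defect_def vec_eq_iff del: atLeastAtMost_iff)
  finally show ?thesis .
qed

lemma param_image:
  "param ` solutions = {v \<in> I \<rightarrow>\<^sub>E UNIV. \<forall>f\<in>(\<lambda>(i, a). defect i a) ` I. f v = 0}"
proof -
  have "v \<in> param ` solutions \<longleftrightarrow> v \<in> I \<rightarrow>\<^sub>E UNIV \<and> fill (choice_of v) \<in> solutions" for v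
  proof
    assume "v \<in> param ` solutions"
    then obtain c where "c \<in> solutions" "v = param c" by blast
    then show "v \<in> I \<rightarrow>\<^sub>E UNIV \<and> fill (choice_of v) \<in> solutions"
      by (simp add: fill_param) (simp add: param_def)
  next
    assume v: "v \<in> I \<rightarrow>\<^sub>E UNIV \<and> fill (choice_of v) \<in> solutions"
    then have "v = param (fill (choice_of v))" by (simp add: param_fill)
    then show "v \<in> param ` solutions" using v by blast
  qed
  then show ?thesis by (auto simp: fill_choice_in_solutions_iff I_def)
qed

text \<open>
  At a singular step the coefficient is a coordinate of \<open>v\<close>; at a regular one it is a linear image of
  the inhomogeneity, which is polynomial by induction.
\<close>

lemma fill_polynomial: "polynomial_fun I (\<lambda>v. fill (choice_of v) j $ a)"
proof (induction j arbitrary: a rule: less_induct)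
  case (less j)
  show ?case
  proof (cases "j \<le> N")
    case True
    then show ?thesis by (simp add: fill_init polynomial_fun.const)
  next
    case False
    define l where "l = j - (N + 1)"
    have j: "j = N + 1 + l" using False by (simp add: l_def)
    show ?thesis
    proof (cases "det (A l) = 0")
      case True
      then obtain i where i: "i \<in> {1..p}" "l = lbar i" using root_iff by blast
      then have "(i, a) \<in> I" by (simp add: I_def)
      then have "polynomial_fun I (\<lambda>v. v (i, a))" by (rule polynomial_fun.coord)
      then show ?thesis unfolding j i(2) fill_choice_of_root[OF i(1)] by simp
    next
      case False
      \<comment> \<open>The induction hypothesis covers the coefficients up to \<open>N + l\<close> only; cutting off the others does not change \<open>R l\<close>.\<close>
      define C where "C = (\<lambda>v i. if i \<le> N + l then fill (choice_of v) i else 0)"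
      have "R l (fill (choice_of v)) = R l (C v)" for v by (rule R_cong) (simp add: C_def)
      moreover have "polynomial_fun I (\<lambda>v. R l (C v) $ b)" for b
      proof (rule R_polynomial)
        show "C v i = c0 i" if "i \<le> N" for v i using that by (simp add: C_def fill_init)
        show "polynomial_fun I (\<lambda>v. C v i $ a)" for i a
          using less[of i a] by (cases "i \<le> N + l") (simp_all add: C_def j polynomial_fun.const)
      qed
      ultimately have R: "polynomial_fun I (\<lambda>v. R l (fill (choice_of v)) $ b)" for b by simp
      have "fill (choice_of v) j $ a = (\<Sum>b\<in>UNIV. - matrix_inv (A l) $ a $ b * R l (fill (choice_of v)) $ b)" for v
        unfolding j fill_step next_coeff_def using False
        by (simp add: matrix_vector_mult_def sum_negf)
      then show ?thesis
        by (simp only:) (intro polynomial_fun_sum polynomial_fun.mult polynomial_fun.const R)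
    qed
  qed
qed

lemma defect_polynomial:
  assumes "i \<in> {1..p}"
  shows "polynomial_fun I (defect i a)"
proof -
  have "polynomial_fun I (\<lambda>v. R (lbar i) (fill (choice_of v)) $ a)"
    by (rule R_polynomial) (simp_all add: fill_init fill_polynomial)
  moreover have "polynomial_fun I (\<lambda>v. v (i, b))" for b
    by (rule polynomial_fun.coord) (use assms in \<open>simp add: I_def\<close>)
  ultimately have "polynomial_fun I (\<lambda>v. (\<Sum>b\<in>UNIV. A (lbar i) $ a $ b * v (i, b)) + R (lbar i) (fill (choice_of v)) $ a)"
    by (intro polynomial_fun.add polynomial_fun_sum polynomial_fun.mult polynomial_fun.const)
  moreover have "defect i a = (\<lambda>v. (\<Sum>b\<in>UNIV. A (lbar i) $ a $ b * v (i, b)) + R (lbar i) (fill (choice_of v)) $ a)"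
    by (simp add: defect_def fun_eq_iff matrix_vector_mult_def)
  ultimately show ?thesis by simp
qed

lemma algebraic_set_param_image: "algebraic_set I (param ` solutions)"
  unfolding param_image
proof (rule algebraic_set_zeros)
  fix f assume "f \<in> (\<lambda>(i, a). defect i a) ` I"
  then obtain i a where "i \<in> {1..p}" "f = defect i a" by (auto simp: I_def)
  then show "polynomial_fun I f" using defect_polynomial by blast
qed

text \<open>
  Keep the given choice at all singular steps but the last, and there move along a direction in the
  kernel of \<open>A (lbar p)\<close>. Up to this step the sequence stays the given one, so all singular equations
  remain satisfied; the later steps are regular and impose no condition.
\<close>

lemma line_in_param_image:
  assumes "1 \<le> p" and c_init: "\<forall>i\<le>N. c i = c0 i"
    and c_rec: "\<forall>l<lbar p. A l *v c (N + 1 + l) + R l c = 0"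
    and c_range: "R (lbar p) c \<in> range ((*v) (A (lbar p)))"
  shows "\<exists>q v w. q \<in> I \<and> w q \<noteq> 0 \<and> line I v w \<subseteq> param ` solutions"
proof -
  have p: "p \<in> {1..p}" using assms(1) by simp
  obtain y where y: "R (lbar p) c = A (lbar p) *v y" using c_range by blast
  have "\<not> invertible (A (lbar p))" using det_root[OF p] by (simp add: invertible_det_nz)
  then obtain u where u: "A (lbar p) *v u = 0" "u \<noteq> 0"
    unfolding invertible_left_inverse matrix_left_invertible_ker by blast
  then obtain a where a: "u $ a \<noteq> 0" by (auto simp: vec_eq_iff)
  define v where "v = (\<lambda>(i, a). if i = p then - y $ a else c (N + 1 + lbar i) $ a)"
  define w where "w = (\<lambda>(i, a). if i = p then u $ a else 0)"
  have "(\<lambda>q\<in>I. v q + t * w q) \<in> param ` solutions" for t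
  proof -
    define V where "V = (\<lambda>q\<in>I. v q + t * w q)"
    have V_less: "(\<chi> a. V (i, a)) = c (N + 1 + lbar i)" if "i \<in> {1..p}" "i \<noteq> p" for i
      using that by (simp add: V_def I_def v_def w_def vec_eq_iff)
    have V_p: "(\<chi> a. V (p, a)) = - y + t *s u"
      using p by (simp add: V_def I_def v_def w_def vec_eq_iff)
    have root_less: "i \<noteq> p" if "lbar i < lbar p" for i using that by auto
    have agree: "fill (choice_of V) j = c j" if "j \<le> N + lbar p" for j
      using that
    proof (induction j rule: less_induct)
      case (less j)
      show ?case
      proof (cases "j \<le> N")
        case True
        then show ?thesis using c_init by (simp add: fill_init)
      next
        case False
        define l where "l = j - (N + 1)"
        have j: "j = N + 1 + l" and l: "l < lbar p" using False less.prems by (simp_all add: l_def)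
        show ?thesis
        proof (cases "det (A l) = 0")
          case True
          then obtain i where i: "i \<in> {1..p}" "l = lbar i" using root_iff by blast
          then have "i \<noteq> p" using l root_less by blast
          then show ?thesis unfolding j i(2) fill_choice_of_root[OF i(1)] using V_less[OF i(1)] by simp
        next
          case False
          have "R l (fill (choice_of V)) = R l c" by (rule R_cong) (use less j in simp)
          moreover have "c (N + 1 + l) = - (matrix_inv (A l) *v R l c)"
            using c_rec l invertible_solve_iff[OF False] by blast
          ultimately show ?thesis unfolding j fill_step next_coeff_def using False by simp
        qed
      qed
    qed
    have mono_le: "lbar i \<le> lbar p" if "i \<in> {1..p}" for i
      using strict_mono_on_leD[OF mono that p] that by simp
    have R_eq: "R (lbar i) (fill (choice_of V)) = R (lbar i) c" if "i \<in> {1..p}" for i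
      by (rule R_cong, rule agree) (use mono_le[OF that] in simp)
    have "A (lbar i) *v (\<chi> a. V (i, a)) + R (lbar i) (fill (choice_of V)) = 0" if i: "i \<in> {1..p}" for i
    proof (cases "i = p")
      case True
      have "A (lbar p) *v (- y + t *s u) + A (lbar p) *v y = A (lbar p) *v (t *s u)"
        by (simp add: matrix_vector_right_distrib[symmetric])
      also have "\<dots> = 0" by (simp add: vector_scalar_commute u(1))
      finally show ?thesis using R_eq[OF i] by (simp add: True V_p y)
    next
      case False
      have "lbar i < lbar p" using strict_mono_onD[OF mono i p] i False by simp
      then show ?thesis using c_rec by (simp only: V_less[OF i False] R_eq[OF i])
    qed
    then have "fill (choice_of V) \<in> solutions"
      unfolding fill_choice_in_solutions_iff defect_def by simp
    moreover have "param (fill (choice_of V)) = V" by (rule param_fill) (simp add: V_def)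
    ultimately show ?thesis unfolding V_def[symmetric] by (metis image_eqI)
  qed
  then have "line I v w \<subseteq> param ` solutions" unfolding line_def by blast
  moreover have "(p, a) \<in> I" "w (p, a) \<noteq> 0" using p a by (simp_all add: I_def w_def)
  ultimately show ?thesis by blast
qed

theorem dimension_param_image:
  assumes "1 \<le> p" "\<forall>i\<le>N. c i = c0 i" "\<forall>l<lbar p. A l *v c (N + 1 + l) + R l c = 0"
    "R (lbar p) c \<in> range ((*v) (A (lbar p)))"
  shows "\<exists>q. algebraic_dim I (param ` solutions) = enat q \<and> 1 \<le> q \<and> q \<le> p * CARD('d)"
proof -
  obtain q v w where l: "q \<in> I" "w q \<noteq> 0" "line I v w \<subseteq> param ` solutions"
    using line_in_param_image[OF assms] by blast
  define x where "x = (\<lambda>t. \<lambda>q\<in>I. v q + t * w q)"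
  have in_line: "x t \<in> line I v w" for t unfolding line_def x_def by (rule rangeI)
  have "x 1 q \<noteq> x 0 q" using l by (simp add: x_def)
  then have "x 1 \<notin> {x 0}" by auto
  then have sub: "{x 0} \<subset> line I v w" using in_line[of 0] in_line[of 1] by blast
  have "irreducible_algebraic_set I {x 0}" by (rule irreducible_singleton) (simp add: x_def)
  moreover have "irreducible_algebraic_set I (line I v w)" by (rule irreducible_line[of q I w v, OF l(1,2)])
  moreover have "finite I" "card I = p * CARD('d)" by (simp_all add: I_def)
  ultimately show ?thesis using algebraic_dim_bounds[OF _ _ _ sub l(3)] by metis
qed

end

section \<open>Power series solutions of the system\<close>

text \<open>
  The remainder is a Taylor coefficient of the truncated sequence. Its dependence on \<open>c_0, ..., c_n\<close>, which form
  the base point \<open>z_0\<close>, is not polynomial in general, so these coefficients are held fixed.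
\<close>

lemma R_bar_polynomial:
  fixes G :: "'k::{real_normed_field,euclidean_space} \<times> (('k^'d)^('j::{finite,linorder})) \<Rightarrow> 'k^'d"
  assumes G: "C_infinity G" and n: "CARD('j) = n + 1"
    and init: "\<And>v i. i \<le> n \<Longrightarrow> C v i = c i"
    and poly: "\<And>i a. polynomial_fun I (\<lambda>v. C v i $ a)"
  shows "polynomial_fun I (\<lambda>v. R_bar G n k l (C v) $ a)"
proof -
  define z :: "(_ \<Rightarrow> 'k) \<Rightarrow> nat \<Rightarrow> 'k^(('j \<times> 'd) option)"
    where "z = (\<lambda>v s. coords (subst_series (truncate_seq (k + l + n) (C v)) s))"
  have "polynomial_fun I (\<lambda>v. taylor_coeff (\<lambda>u. G (point u) $ a) (2 * k + 1 + l) (z v))"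
  proof (rule taylor_coeff_polynomial)
    have "idx j \<le> n" for j :: 'j by (rule idx_le[OF n])
    then show "z v 0 = coords (subst_series (truncate_seq (k + l + n) c) 0)" for v
      by (simp add: z_def subst_series_def truncate_seq_def init vec_eq_iff coords_def split: option.split)
    show "polynomial_fun I (\<lambda>v. z v (Suc s) $ e)" for s e
    proof (cases e)
      case None
      then show ?thesis by (simp add: z_def subst_series_def polynomial_fun.const)
    next
      case (Some q)
      obtain j b where "q = (j, b)" by (cases q)
      then show ?thesis using poly
        by (cases "Suc (s + idx j) \<le> k + l + n")
          (simp_all add: Some z_def subst_series_def truncate_seq_def polynomial_fun.const)
    qed
  qed
  then show ?thesis by (simp add: R_bar_eq[OF G n] T_eq_taylor_coeff[OF G] z_def)
qed

theorem theorem2: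
  fixes G :: "'k::{real_normed_field,euclidean_space} \<times> (('k^'d)^('j::{finite,linorder})) \<Rightarrow> 'k^'d"
    and m n :: nat
    and c :: "nat \<Rightarrow> 'k^'d"
  assumes n: "CARD('j) = n + 1"
    and m: "m \<ge> 1"
    and smooth: "C_infinity G"
    and init: "G (0, \<chi> j. c (idx j)) = 0"
    and S_prev: "S G n (m - 1) c = (\<lambda>i s. 0)"
    and S_m: "S G n m c \<noteq> (\<lambda>i s. 0)"
    and R_odd: "\<forall>k<m. R_bar G n k 0 c = 0"
    and R_even: "\<forall>k<m. R_bar G n k 1 c = 0"
  shows "((\<forall>l. g G n m l c \<noteq> 0) \<longrightarrow>
            (\<exists>!c'. c' \<in> continuations G (m + n) c) \<and>
            (\<forall>c'\<in>continuations G (m + n) c. \<forall>l.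
               invertible (H G n m l c) \<and>
               c' (m + 1 + l + n) = - (matrix_inv (H G n m l c) *v R_bar G n m l c')))
       \<and> (\<forall>(p::nat) (lbar :: nat \<Rightarrow> nat).
            1 \<le> p \<and> p \<le> m * CARD('d) \<and> strict_mono_on {1..p} lbar \<and>
            {l. g G n m l c = 0} = lbar ` {1..p} \<and>
            (\<exists>c'. (\<forall>i\<le>m + n. c' i = c i) \<and>
                  (\<forall>l<lbar p. H G n m l c *v c' (m + 1 + l + n) + R_bar G n m l c' = 0) \<and>
                  (\<forall>i\<in>{1..p}. R_bar G n m (lbar i) c' \<in> range ((*v) (H G n m (lbar i) c))))
            \<longrightarrow>
            (let I = {1..p} \<times> (UNIV :: 'd set);
                 param = (\<lambda>c'. \<lambda>(i, a)\<in>I. c' (m + 1 + lbar i + n) $ a);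
                 F = continuations G (m + n) c
             in inj_on param F \<and> algebraic_set I (param ` F) \<and>
                (\<exists>q::nat. algebraic_dim I (param ` F) = enat q \<and> 1 \<le> q \<and> q \<le> m * CARD('d) ^ 2)))"
proof -
  have shift: "m + 1 + l + n = m + n + 1 + l" for l by simp
  interpret linear_recursion "\<lambda>l. H G n m l c" "R_bar G n m" "m + n" c
    by unfold_locales (rule R_bar_cong[OF smooth n], simp)
  have sol: "continuations G (m + n) c = solutions"
    unfolding solutions_def
    using continuations_iff[OF smooth n m init S_prev R_odd R_even] by (auto simp only: shift)
  show ?thesis
    unfolding sol shift g_def
  proof (intro conjI impI allI ballI)
    assume regular: "\<forall>l. det (H G n m l c) \<noteq> 0"
    show "\<exists>!c'. c' \<in> solutions" by (rule unique_solution_if_regular[OF regular])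
    fix c' l assume c': "c' \<in> solutions"
    show "invertible (H G n m l c)" using regular by (simp add: invertible_det_nz)
    show "c' (m + n + 1 + l) = - (matrix_inv (H G n m l c) *v R_bar G n m l c')"
      by (rule solutions_step[OF c']) (use regular in simp)
  next
    fix p :: nat and lbar :: "nat \<Rightarrow> nat"
    assume A: "1 \<le> p \<and> p \<le> m * CARD('d) \<and> strict_mono_on {1..p} lbar \<and>
      {l. det (H G n m l c) = 0} = lbar ` {1..p} \<and>
      (\<exists>c'. (\<forall>i\<le>m + n. c' i = c i) \<and>
            (\<forall>l<lbar p. H G n m l c *v c' (m + n + 1 + l) + R_bar G n m l c' = 0) \<and>
            (\<forall>i\<in>{1..p}. R_bar G n m (lbar i) c' \<in> range ((*v) (H G n m (lbar i) c))))"
    then have p: "1 \<le> p" "p \<le> m * CARD('d)" and mono: "strict_mono_on {1..p} lbar"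
      and roots: "{l. det (H G n m l c) = 0} = lbar ` {1..p}" by blast+
    from A obtain c' where c': "\<forall>i\<le>m + n. c' i = c i"
      "\<forall>l<lbar p. H G n m l c *v c' (m + n + 1 + l) + R_bar G n m l c' = 0"
      "\<forall>i\<in>{1..p}. R_bar G n m (lbar i) c' \<in> range ((*v) (H G n m (lbar i) c))" by blast
    interpret polynomial_recursion "\<lambda>l. H G n m l c" "R_bar G n m" "m + n" c p lbar
    proof unfold_locales
      fix I :: "(nat \<times> 'd) set" and C :: "(nat \<times> 'd \<Rightarrow> 'k) \<Rightarrow> nat \<Rightarrow> 'k^'d" and l a
      assume "\<And>v i. i \<le> m + n \<Longrightarrow> C v i = c i" "\<And>i a. polynomial_fun I (\<lambda>v. C v i $ a)"
      then show "polynomial_fun I (\<lambda>v. R_bar G n m l (C v) $ a)"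
        by (intro R_bar_polynomial[OF smooth n, where c=c]) simp_all
    qed (fact mono roots)+
    have "R_bar G n m (lbar p) c' \<in> range ((*v) (H G n m (lbar p) c))" using c'(3) p(1) by simp
    from dimension_param_image[OF p(1) c'(1,2) this] obtain q where
      q: "algebraic_dim I (param ` solutions) = enat q" "1 \<le> q" "q \<le> p * CARD('d)" by blast
    have "q \<le> m * CARD('d) * CARD('d)"
      by (rule order_trans[OF q(3)], rule mult_right_mono[OF p(2)]) simp
    then have bound: "q \<le> m * CARD('d) ^ 2" by (simp only: power2_eq_square mult.assoc)
    have param_eq: "(\<lambda>c'. \<lambda>(i, a)\<in>{1..p} \<times> UNIV. c' (m + n + 1 + lbar i) $ a) = param"
      by (simp add: fun_eq_iff param_def I_def)
    show "let I = {1..p} \<times> (UNIV :: 'd set);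
        param = (\<lambda>c'. \<lambda>(i, a)\<in>I. c' (m + n + 1 + lbar i) $ a); F = solutions
      in inj_on param F \<and> algebraic_set I (param ` F) \<and>
        (\<exists>q::nat. algebraic_dim I (param ` F) = enat q \<and> 1 \<le> q \<and> q \<le> m * CARD('d) ^ 2)"
      unfolding Let_def param_eq unfolding I_def[symmetric]
      using inj_on_param algebraic_set_param_image q(1,2) bound by blast
  qed
qed

end
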